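(* Let $\mathfrak g$ be a locally reductive finitary Lie algebra and $\mathfrak b\subset\mathfrak g$ a Borel subalgebra. Then $\mathfrak b\cap[\mathfrak g,\mathfrak g]$ is a Borel subalgebra of $[\mathfrak g,\mathfrak g]$.
   Context: Ground field $\mathbb C$; Lie algebras of at most countable dimension. Finitary Lie algebra: locally finite Lie algebra with a faithful representation admitting a basis in which every element acts by a finite matrix. Locally reductive: union of nested finite-dimensional reductive subalgebras $\mathfrak g_n\subset\mathfrak g_{n+1}$ with $\mathfrak g_n$ reductive in $\mathfrak g_{n+1}$ (i.e. $\mathfrak g_{n+1}$ is a semisimple $\mathfrak g_n$-module). Borel subalgebra: maximal locally solvable subalgebra, where locally solvable means every finite subset lies in a finite-dimensional solvable subalgebra. *)

theory Defs
  imports Complex_Main "HOL-Library.Countable_Set"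
begin

text \<open>Complex vector spaces (not provided as a type class by the distribution).\<close>

class complex_vector = ab_group_add +
  fixes scaleC :: "complex \<Rightarrow> 'a \<Rightarrow> 'a" (infixr \<open>*\<^sub>C\<close> 75)
  assumes scaleC_add_right: "scaleC a (x + y) = scaleC a x + scaleC a y"
    and scaleC_add_left: "scaleC (a + b) x = scaleC a x + scaleC b x"
    and scaleC_scaleC: "scaleC a (scaleC b x) = scaleC (a * b) x"
    and scaleC_one: "scaleC 1 x = x"

text \<open>Complex linear span, linear independence and subspaces (via the generic module locale,
  instantiated with complex scalar multiplication).\<close>

abbreviation cspan :: "'a::complex_vector set \<Rightarrow> 'a set" where
  "cspan \<equiv> module.span (*\<^sub>C)"

abbreviation cindependent :: "'a::complex_vector set \<Rightarrow> bool" where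
  "cindependent S \<equiv> \<not> module.dependent (*\<^sub>C) S"

definition csubspace :: "'a::complex_vector set \<Rightarrow> bool" where
  "csubspace S \<longleftrightarrow> 0 \<in> S \<and> (\<forall>x\<in>S. \<forall>y\<in>S. x + y \<in> S) \<and> (\<forall>c. \<forall>x\<in>S. c *\<^sub>C x \<in> S)"

definition finite_dim :: "'a::complex_vector set \<Rightarrow> bool" where
  "finite_dim S \<longleftrightarrow> (\<exists>F. finite F \<and> F \<subseteq> S \<and> cspan F = S)"

definition countable_dim :: "'a::complex_vector set \<Rightarrow> bool" where
  "countable_dim S \<longleftrightarrow> (\<exists>F. countable F \<and> F \<subseteq> S \<and> cspan F = S)"

text \<open>A Lie algebra: a complex subspace L of an ambient complex vector space, with a bracket
  which on L is bilinear, alternating, satisfies the Jacobi identity, and maps L x L into L.\<close>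

definition lie_algebra :: "('a::complex_vector \<Rightarrow> 'a \<Rightarrow> 'a) \<Rightarrow> 'a set \<Rightarrow> bool" where
  "lie_algebra br L \<longleftrightarrow> csubspace L
     \<and> (\<forall>x\<in>L. \<forall>y\<in>L. br x y \<in> L)
     \<and> (\<forall>x\<in>L. \<forall>y\<in>L. \<forall>z\<in>L. br (x + y) z = br x z + br y z \<and> br z (x + y) = br z x + br z y)
     \<and> (\<forall>c. \<forall>x\<in>L. \<forall>y\<in>L. br (c *\<^sub>C x) y = c *\<^sub>C br x y \<and> br x (c *\<^sub>C y) = c *\<^sub>C br x y)
     \<and> (\<forall>x\<in>L. br x x = 0)
     \<and> (\<forall>x\<in>L. \<forall>y\<in>L. \<forall>z\<in>L. br x (br y z) + br y (br z x) + br z (br x y) = 0)"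

definition subalgebra :: "('a::complex_vector \<Rightarrow> 'a \<Rightarrow> 'a) \<Rightarrow> 'a set \<Rightarrow> 'a set \<Rightarrow> bool" where
  "subalgebra br L S \<longleftrightarrow> S \<subseteq> L \<and> csubspace S \<and> (\<forall>x\<in>S. \<forall>y\<in>S. br x y \<in> S)"

text \<open>Bracket of two subsets: the span of all brackets.\<close>
definition brset :: "('a::complex_vector \<Rightarrow> 'a \<Rightarrow> 'a) \<Rightarrow> 'a set \<Rightarrow> 'a set \<Rightarrow> 'a set" where
  "brset br A B = cspan {br x y | x y. x \<in> A \<and> y \<in> B}"

text \<open>Derived algebra [L,L].\<close>
definition derived :: "('a::complex_vector \<Rightarrow> 'a \<Rightarrow> 'a) \<Rightarrow> 'a set \<Rightarrow> 'a set" where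
  "derived br L = brset br L L"

fun derived_series :: "('a::complex_vector \<Rightarrow> 'a \<Rightarrow> 'a) \<Rightarrow> 'a set \<Rightarrow> nat \<Rightarrow> 'a set" where
  "derived_series br L 0 = L"
| "derived_series br L (Suc n) = derived br (derived_series br L n)"

definition solvable :: "('a::complex_vector \<Rightarrow> 'a \<Rightarrow> 'a) \<Rightarrow> 'a set \<Rightarrow> bool" where
  "solvable br L \<longleftrightarrow> (\<exists>n. derived_series br L n = {0})"

definition locally_finite :: "('a::complex_vector \<Rightarrow> 'a \<Rightarrow> 'a) \<Rightarrow> 'a set \<Rightarrow> bool" where
  "locally_finite br L \<longleftrightarrow>
     (\<forall>F. finite F \<and> F \<subseteq> L \<longrightarrow> (\<exists>T. subalgebra br L T \<and> F \<subseteq> T \<and> finite_dim T))"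

definition locally_solvable :: "('a::complex_vector \<Rightarrow> 'a \<Rightarrow> 'a) \<Rightarrow> 'a set \<Rightarrow> bool" where
  "locally_solvable br L \<longleftrightarrow>
     (\<forall>F. finite F \<and> F \<subseteq> L \<longrightarrow>
        (\<exists>T. subalgebra br L T \<and> F \<subseteq> T \<and> finite_dim T \<and> solvable br T))"

text \<open>Borel subalgebra of L: a maximal locally solvable subalgebra of L.\<close>
definition borel :: "('a::complex_vector \<Rightarrow> 'a \<Rightarrow> 'a) \<Rightarrow> 'a set \<Rightarrow> 'a set \<Rightarrow> bool" where
  "borel br L B \<longleftrightarrow> subalgebra br L B \<and> locally_solvable br B
     \<and> (\<forall>C. subalgebra br L C \<and> locally_solvable br C \<and> B \<subseteq> C \<longrightarrow> C = B)"

text \<open>A is reductive in B: A \<subseteq> B subalgebras and B is a semisimple (completely reducible)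
  A-module under the adjoint action, i.e. every ad(A)-stable subspace of B has an
  ad(A)-stable complement in B.\<close>
definition ad_stable :: "('a::complex_vector \<Rightarrow> 'a \<Rightarrow> 'a) \<Rightarrow> 'a set \<Rightarrow> 'a set \<Rightarrow> bool" where
  "ad_stable br A U \<longleftrightarrow> (\<forall>a\<in>A. \<forall>u\<in>U. br a u \<in> U)"

definition reductive_in :: "('a::complex_vector \<Rightarrow> 'a \<Rightarrow> 'a) \<Rightarrow> 'a set \<Rightarrow> 'a set \<Rightarrow> bool" where
  "reductive_in br A B \<longleftrightarrow> A \<subseteq> B \<and>
     (\<forall>U. csubspace U \<and> U \<subseteq> B \<and> ad_stable br A U \<longrightarrow>
        (\<exists>W. csubspace W \<and> W \<subseteq> B \<and> ad_stable br A W \<and> U \<inter> W = {0}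
             \<and> {u + w | u w. u \<in> U \<and> w \<in> W} = B))"

text \<open>Finite-dimensional reductive Lie algebra: reductive in itself (adjoint representation
  semisimple).\<close>
definition reductive :: "('a::complex_vector \<Rightarrow> 'a \<Rightarrow> 'a) \<Rightarrow> 'a set \<Rightarrow> bool" where
  "reductive br A \<longleftrightarrow> reductive_in br A A"

definition locally_reductive :: "('a::complex_vector \<Rightarrow> 'a \<Rightarrow> 'a) \<Rightarrow> 'a set \<Rightarrow> bool" where
  "locally_reductive br L \<longleftrightarrow> (\<exists>G :: nat \<Rightarrow> 'a set.
     (\<forall>n. subalgebra br L (G n) \<and> finite_dim (G n) \<and> reductive br (G n))
     \<and> (\<forall>n. G n \<subseteq> G (Suc n))
     \<and> (\<forall>n. reductive_in br (G n) (G (Suc n)))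
     \<and> (\<Union>n. G n) = L)"

text \<open>Finitary: locally finite, with a faithful representation on a complex vector space
  (carried by a type 'v) admitting a basis in which every element acts by a finite matrix
  (only finitely many nonzero matrix entries).\<close>
definition finite_matrix :: "'v::complex_vector set \<Rightarrow> ('v \<Rightarrow> 'v) \<Rightarrow> bool" where
  "finite_matrix Bs f \<longleftrightarrow> finite {b\<in>Bs. f b \<noteq> 0}
     \<and> (\<exists>Bs0. finite Bs0 \<and> Bs0 \<subseteq> Bs \<and> range f \<subseteq> cspan Bs0)"

definition faithful_rep :: "('a::complex_vector \<Rightarrow> 'a \<Rightarrow> 'a) \<Rightarrow> 'a set \<Rightarrow> ('a \<Rightarrow> 'v::complex_vector \<Rightarrow> 'v) \<Rightarrow> bool" where
  "faithful_rep br L \<rho> \<longleftrightarrow>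
     (\<forall>x\<in>L. \<forall>u v. \<rho> x (u + v) = \<rho> x u + \<rho> x v)
     \<and> (\<forall>x\<in>L. \<forall>c u. \<rho> x (c *\<^sub>C u) = c *\<^sub>C \<rho> x u)
     \<and> (\<forall>x\<in>L. \<forall>y\<in>L. \<rho> (x + y) = (\<lambda>u. \<rho> x u + \<rho> y u))
     \<and> (\<forall>c. \<forall>x\<in>L. \<rho> (c *\<^sub>C x) = (\<lambda>u. c *\<^sub>C \<rho> x u))
     \<and> (\<forall>x\<in>L. \<forall>y\<in>L. \<rho> (br x y) = (\<lambda>u. \<rho> x (\<rho> y u) - \<rho> y (\<rho> x u)))
     \<and> inj_on \<rho> L"

definition finitary :: "'v::complex_vector itself \<Rightarrow> ('a::complex_vector \<Rightarrow> 'a \<Rightarrow> 'a) \<Rightarrow> 'a set \<Rightarrow> bool" where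
  "finitary _ br L \<longleftrightarrow> locally_finite br L \<and>
     (\<exists>(\<rho> :: 'a \<Rightarrow> 'v \<Rightarrow> 'v) Bs. cindependent Bs \<and> cspan Bs = UNIV
        \<and> faithful_rep br L \<rho> \<and> (\<forall>x\<in>L. finite_matrix Bs (\<rho> x)))"

end

theory Submission
  imports Defs "HOL-Computational_Algebra.Fundamental_Theorem_Algebra"
begin

text \<open>
  Let $C$ be a locally solvable subalgebra of $[g,g]$ containing $b \cap [g,g]$. Finitariness enters
  through one estimate: every element of $[g,g]$ lies in an ideal $I \subseteq [g,g]$ of $g$ such
  that $I + Z$ has finite codimension in $g$, where $Z$ is the centralizer of $I$. By maximality of
  $b$, the elements of $b \cap (I + Z)$ act on $I$ like elements of $b \cap I$, hence normalize
  $D = C \cap I$; so do the elements of $b \cap [g,g]$, and therefore only finitely many further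
  elements $y \in b$ have to be treated. For each of them replace $D$ by the limit of
  $\exp(t\,\mathrm{ad}\,y) D$ as $t$ tends to infinity in a generic direction. The limit is again a
  locally solvable subalgebra, it is stable under $y$ and under everything that $D$ was stable under,
  and it cannot collapse to $b \cap I$ unless $D = b \cap I$. Once $D$ is stable under all of $b$,
  the sum $b + D$ is locally solvable, so $D \subseteq b$ by maximality.
\<close>

section \<open>Codimension\<close>

text \<open>A finite-dimensional reductive g is [g,g] plus its center, so b acts on [g,g] through
  elements of b in [g,g]. This fails already for gl of infinite rank: the center is 0 and [g,g] has
  codimension one. Then b is not known to normalize C, and b + C need not be a subalgebra; hence the
  detour through a D that b does normalize.

  The ideal I is generated by H = [\<open>G 0\<close>, \<open>G 0\<close>], for a chain that starts
  late enough for H to contain the given element. An element commuting with I acts on the space H V,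
  where V is the representation space; it has finite dimension because H is spanned by finitely many
  operators of finite rank. The codimension bound is (dim H V)^2.

  The flow is treated by algebra, without topology: leading terms stand for the limit along the
  semisimple part of ad y, top coefficients of polynomial curves for the limit along the nilpotent
  part. Collapse is excluded because both limits can be undone term by term: if the limit of D lies
  in a y-stable subspace E of D, then subtracting leading terms or top coefficients, which lie in E,
  exhausts D, so D = E.\<close>

global_interpretation cv: vector_space "scaleC :: complex \<Rightarrow> 'a::complex_vector \<Rightarrow> 'a"
  by unfold_locales (simp_all add: scaleC_add_right scaleC_add_left scaleC_scaleC scaleC_one)

lemma csubspace_iff: "csubspace S \<longleftrightarrow> cv.subspace S"
  by (auto simp: csubspace_def cv.subspace_def)

lemma span_insert_decomp:
  assumes "cv.subspace P" "z \<in> cspan (insert x P)"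
  obtains c p where "p \<in> P" "z = c *\<^sub>C x + p"
proof -
  obtain c where "z - c *\<^sub>C x \<in> cspan P"
    using assms(2) cv.span_breakdown_eq by blast
  then have "z - c *\<^sub>C x \<in> P"
    using assms(1) by (metis cv.span_eq_iff)
  then show thesis
    using that[of "z - c *\<^sub>C x" c] by simp
qed

lemma span_insert_exchange:
  assumes "cv.subspace P" "z \<in> cspan (insert x P)" "z \<notin> P"
  shows "cspan (insert x P) \<subseteq> cspan (insert z P)"
proof -
  obtain c p where p: "p \<in> P" "z = c *\<^sub>C x + p"
    using span_insert_decomp[OF assms(1,2)] .
  have "c \<noteq> 0" using p assms(3) by auto
  then have "x = inverse c *\<^sub>C (z - p)"
    using p by simp
  moreover have "z - p \<in> cspan (insert z P)"
    using p(1) by (intro cv.span_diff cv.span_base) auto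
  ultimately have "x \<in> cspan (insert z P)"
    by (metis cv.span_scale)
  then show ?thesis
    by (intro cv.span_minimal) (auto intro: cv.span_base)
qed

text \<open>For subspaces $X$ and $P$, \<open>codim_le n X P\<close> means that $(X + P)/P$ has dimension at most $n$.\<close>

primrec codim_le :: "nat \<Rightarrow> 'a::complex_vector set \<Rightarrow> 'a set \<Rightarrow> bool" where
  "codim_le 0 X P \<longleftrightarrow> X \<subseteq> P"
| "codim_le (Suc n) X P \<longleftrightarrow> (\<forall>x\<in>X - P. codim_le n X (cspan (insert x P)))"

lemma codim_le_mono:
  assumes "codim_le n X P" "P \<subseteq> P'"
  shows "codim_le n X P'"
  using assms
proof (induction n arbitrary: P P')
  case (Suc n)
  have "codim_le n X (cspan (insert x P'))" if "x \<in> X - P'" for x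
    by (rule Suc.IH[of "cspan (insert x P)"]) (use Suc.prems that in \<open>auto intro!: cv.span_mono\<close>)
  then show ?case by simp
qed auto

text \<open>Since Y lies in P + X, its image modulo P lies in that of X. In the induction, y and its
  X-component x differ by an element of P, so inserting either into P gives the same span.\<close>

lemma codim_le_sum:
  assumes "codim_le n X P" "cv.subspace P" "\<And>y. y \<in> Y \<Longrightarrow> \<exists>p\<in>P. \<exists>x\<in>X. y = p + x"
  shows "codim_le n Y P"
  using assms
proof (induction n arbitrary: P)
  case 0
  then show ?case by (metis codim_le.simps(1) cv.subspace_add subset_iff)
next
  case (Suc n)
  have "codim_le n Y (cspan (insert y P))" if y: "y \<in> Y - P" for y
  proof -
    obtain p x where px: "p \<in> P" "x \<in> X" "y = p + x" using Suc.prems(3) y by blast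
    then have "x \<notin> P" using y Suc.prems(2) by (auto dest: cv.subspace_add)
    then have *: "codim_le n X (cspan (insert x P))" using Suc.prems(1) px by auto
    have "codim_le n Y (cspan (insert x P))"
      by (rule Suc.IH[OF *]) (use Suc.prems(3) in \<open>auto, meson cv.span_base insertI2\<close>)
    moreover have "y \<in> cspan (insert y P)" "p \<in> cspan (insert y P)"
      using px(1) by (auto intro: cv.span_base)
    then have "x \<in> cspan (insert y P)"
      using cv.span_diff[of y "insert y P" p] px by simp
    then have "cspan (insert x P) \<subseteq> cspan (insert y P)"
      by (intro cv.span_minimal) (auto intro: cv.span_base)
    ultimately show ?thesis using codim_le_mono by blast
  qed
  then show ?case by simp
qed

lemma codim_le_subset: "codim_le n X P \<Longrightarrow> X' \<subseteq> X \<Longrightarrow> codim_le n X' P"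
  by (induction n arbitrary: P) auto

text \<open>The second isomorphism theorem: X / (X \<inter> P) is (X + P) / P. The inductive step is
  the modular law.\<close>

lemma codim_le_Int:
  assumes "codim_le n X P" "cv.subspace X" "cv.subspace P"
  shows "codim_le n X (X \<inter> P)"
  using assms
proof (induction n arbitrary: P)
  case (Suc n)
  have "codim_le n X (cspan (insert x (X \<inter> P)))" if x: "x \<in> X" "x \<notin> P" for x
  proof -
    have "codim_le n X (X \<inter> cspan (insert x P))"
      using Suc x by auto
    moreover have "X \<inter> cspan (insert x P) \<subseteq> cspan (insert x (X \<inter> P))"
    proof
      fix z assume z: "z \<in> X \<inter> cspan (insert x P)"
      then obtain c p where p: "p \<in> P" "z = c *\<^sub>C x + p"
        using span_insert_decomp[OF Suc.prems(3)] by blast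
      have "p = z - c *\<^sub>C x" using p by simp
      then have "p \<in> X" using z x Suc.prems(2) by (auto intro: cv.subspace_diff cv.subspace_scale)
      then have "c *\<^sub>C x + p \<in> cspan (insert x (X \<inter> P))"
        using p by (intro cv.span_add cv.span_scale cv.span_base) auto
      then show "z \<in> cspan (insert x (X \<inter> P))"
        using p by simp
    qed
    ultimately show ?thesis using codim_le_mono by blast
  qed
  then show ?case by auto
qed auto

lemma codim_le_Union:
  assumes "\<And>m. codim_le n (R m) P" "\<And>m. R m \<subseteq> R (Suc m)"
  shows "codim_le n (\<Union>m. R m) P"
  using assms
proof (induction n arbitrary: R P)
  case 0
  then show ?case by auto
next
  case (Suc n)
  have mono: "R i \<subseteq> R j" if "i \<le> j" for i j
    using lift_Suc_mono_le[of R, OF Suc.prems(2) that] .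
  have "codim_le n (\<Union>m. R m) (cspan (insert x P))" if x: "x \<in> R m" "x \<notin> P" for x m
  proof -
    \<comment> \<open>The chain is restarted at m, so that x lies in each remaining term and the
      hypothesis applies to all of them with this x.\<close>
    have "codim_le n (\<Union>k. R (m + k)) (cspan (insert x P))"
    proof (rule Suc.IH)
      fix k
      show "codim_le n (R (m + k)) (cspan (insert x P))"
        using Suc.prems(1)[of "m + k"] x mono[of m "m + k"] by auto
      show "R (m + k) \<subseteq> R (m + Suc k)" using Suc.prems(2) by simp
    qed
    moreover have "(\<Union>m. R m) \<subseteq> (\<Union>k. R (m + k))"
      using mono[OF le_add2] by fast
    ultimately show ?thesis using codim_le_subset by blast
  qed
  then show ?case by auto
qed

text \<open>P exceeds P0 by at most the one dimension that q supplies. A vector of P outside P0 can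
  be exchanged for q and uses up this dimension; a vector outside P is counted by the hypothesis,
  and q stays available.\<close>

lemma codim_le_Suc_trans:
  assumes "codim_le n X P" "P \<subseteq> cspan (insert q P0)" "cv.subspace P0"
  shows "codim_le (Suc n) X P0"
  using assms
proof (induction n arbitrary: P P0)
  case 0
  have "X \<subseteq> cspan (insert x P0)" if "x \<in> X - P0" for x
    using span_insert_exchange[OF 0(3), of x q] that 0 by auto
  then show ?case by simp
next
  case (Suc n)
  have "codim_le (Suc n) X (cspan (insert x P0))" if x: "x \<in> X" "x \<notin> P0" for x
  proof (cases "x \<in> P")
    case True
    then have "P \<subseteq> cspan (insert x P0)"
      using span_insert_exchange[OF Suc.prems(3), of x q] x Suc.prems(2) by blast
    then show ?thesis using Suc.prems(1) codim_le_mono by blast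
  next
    case False
    then have *: "codim_le n X (cspan (insert x P))" using Suc.prems(1) x by simp
    have "cspan (insert x P) \<subseteq> cspan (insert q (cspan (insert x P0)))"
    proof (rule cv.span_minimal)
      have "cspan (insert q P0) \<subseteq> cspan (insert q (cspan (insert x P0)))"
        by (rule cv.span_mono) (auto intro: cv.span_base)
      then show "insert x P \<subseteq> cspan (insert q (cspan (insert x P0)))"
        using Suc.prems(2) by (auto intro: cv.span_base)
    qed auto
    then show ?thesis using Suc.IH[OF *] by auto
  qed
  then show ?case by auto
qed

text \<open>Rank-nullity, one vector of F at a time: the elements whose image lies in the span of
  the smaller set form a subspace of codimension at most one in P.\<close>

lemma codim_le_kernel:
  fixes \<phi> :: "'a::complex_vector \<Rightarrow> 'v::complex_vector"
  assumes "finite F" "codim_le n X P" "cv.subspace P" "\<And>p. p \<in> P \<Longrightarrow> \<phi> p \<in> cspan F"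
    and \<phi>: "\<And>x y. \<phi> (x + y) = \<phi> x + \<phi> y" "\<And>c x. \<phi> (c *\<^sub>C x) = c *\<^sub>C \<phi> x"
  shows "codim_le (n + card F) X {p \<in> P. \<phi> p = 0}"
  using assms(1-4)
proof (induction F arbitrary: n P rule: finite_induct)
  case empty
  then have "{p \<in> P. \<phi> p = 0} = P" by auto
  then show ?case using empty by simp
next
  case (insert f F)
  define P0 where "P0 = {p \<in> P. \<phi> p \<in> cspan F}"
  have \<phi>0: "\<phi> 0 = 0" using \<phi>(2)[of 0 0] by simp
  have sub: "cv.subspace P0"
    unfolding P0_def cv.subspace_def
    using insert.prems(2) by (auto simp: \<phi> \<phi>0 cv.span_zero cv.subspace_0 cv.subspace_add cv.subspace_scale cv.span_add cv.span_scale)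
  have "\<exists>q. P \<subseteq> cspan (insert q P0)"
  proof (cases "P \<subseteq> P0")
    case True
    then show ?thesis by (meson cv.span_superset order_trans subset_insertI)
  next
    case False
    then obtain q where q: "q \<in> P" "\<phi> q \<notin> cspan F" by (auto simp: P0_def)
    have "z \<in> cspan (insert q P0)" if z: "z \<in> P" for z
    proof -
      obtain c where c: "\<phi> q - c *\<^sub>C f \<in> cspan F"
        using insert.prems(3)[OF q(1)] cv.span_breakdown_eq by blast
      obtain d where d: "\<phi> z - d *\<^sub>C f \<in> cspan F"
        using insert.prems(3)[OF z] cv.span_breakdown_eq by blast
      have c0: "c \<noteq> 0" using c q by auto
      \<comment> \<open>Chosen so that the f-coordinates of the images of z and e q cancel.\<close>
      define e where "e = - (d / c)"
      have e: "d = - (e * c)" using c0 by (simp add: e_def)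
      let ?w = "z + e *\<^sub>C q"
      have "\<phi> ?w = (\<phi> z - d *\<^sub>C f) + e *\<^sub>C (\<phi> q - c *\<^sub>C f)"
        by (simp add: \<phi> e cv.scale_right_diff_distrib)
      then have "\<phi> ?w \<in> cspan F" using c d by (metis cv.span_add cv.span_scale)
      then have "?w \<in> P0" using z q insert.prems(2) unfolding P0_def
        by (auto intro!: cv.subspace_add cv.subspace_scale)
      then have "?w + (- e) *\<^sub>C q \<in> cspan (insert q P0)"
        by (intro cv.span_add cv.span_scale cv.span_base) auto
      then show ?thesis by simp
    qed
    then show ?thesis by blast
  qed
  then obtain q where "P \<subseteq> cspan (insert q P0)" ..
  then have "codim_le (Suc n) X P0"
    using codim_le_Suc_trans insert.prems(1) sub by blast
  then have "codim_le (Suc n + card F) X {p \<in> P0. \<phi> p = 0}"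
    by (rule insert.IH) (use sub in \<open>auto simp: P0_def\<close>)
  moreover have "{p \<in> P0. \<phi> p = 0} = {p \<in> P. \<phi> p = 0}"
    by (auto simp: P0_def cv.span_zero)
  ultimately show ?case using insert.hyps by simp
qed

section \<open>Finite-dimensional subspaces and unions of chains\<close>

lemma subspace_finite_dim:
  assumes "cv.subspace S" "S \<subseteq> cspan F" "finite F"
  obtains B where "finite B" "B \<subseteq> S" "cspan B = S"
proof -
  obtain B where B: "B \<subseteq> S" "cindependent B" "S \<subseteq> cspan B" "card B = cv.dim S"
    by (rule cv.basis_exists)
  have "finite B"
    using cv.independent_span_bound[OF assms(3) B(2)] B(1) assms(2) by blast
  moreover have "cspan B = S"
    using B assms(1) by (simp add: cv.span_subspace)
  ultimately show thesis using that B(1) by blast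
qed

lemma chain_finite_subset:
  fixes G :: "nat \<Rightarrow> 'b set"
  assumes "finite F" "F \<subseteq> (\<Union>m. G m)" "\<And>m. G m \<subseteq> G (Suc m)"
  obtains m where "m \<ge> k" "F \<subseteq> G m"
proof -
  have mono: "G i \<subseteq> G j" if "i \<le> j" for i j
    using lift_Suc_mono_le[of G, OF assms(3) that] .
  have "\<exists>m\<ge>k. F \<subseteq> G m"
    using assms(1,2)
  proof (induction F rule: finite_induct)
    case (insert x F)
    then obtain m m' where "m \<ge> k" "F \<subseteq> G m" "x \<in> G m'" by auto
    then show ?case using mono[of m "max m m'"] mono[of m' "max m m'"]
      by (intro exI[of _ "max m m'"]) auto
  qed auto
  then show thesis using that by blast
qed

lemma subspace_Union_chain:
  assumes "\<And>m. cv.subspace (G m)" "\<And>m::nat. G m \<subseteq> G (Suc m)"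
  shows "cv.subspace (\<Union>m. G m)"
proof -
  have "x + y \<in> (\<Union>m. G m)" if "x \<in> (\<Union>m. G m)" "y \<in> (\<Union>m. G m)" for x y
  proof -
    obtain m where "{x, y} \<subseteq> G m"
      using chain_finite_subset[of "{x, y}" G, OF _ _ assms(2)] \<open>x \<in> _\<close> \<open>y \<in> _\<close> by blast
    then have "x + y \<in> G m" using cv.subspace_add[OF assms(1)] by simp
    then show ?thesis by blast
  qed
  moreover have "0 \<in> (\<Union>m. G m)" using cv.subspace_0[OF assms(1)] by blast
  moreover have "c *\<^sub>C x \<in> (\<Union>m. G m)" if "x \<in> (\<Union>m. G m)" for c x
    using cv.subspace_scale[OF assms(1)] that by blast
  ultimately show ?thesis by (intro cv.subspaceI)
qed

section \<open>Brackets and derivations\<close>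

locale lie =
  fixes br :: "'a::complex_vector \<Rightarrow> 'a \<Rightarrow> 'a"
  assumes add_left: "br (x + y) z = br x z + br y z"
    and add_right: "br z (x + y) = br z x + br z y"
    and scale_left: "br (c *\<^sub>C x) y = c *\<^sub>C br x y"
    and scale_right: "br x (c *\<^sub>C y) = c *\<^sub>C br x y"
    and alt: "br x x = 0"
    and jacobi: "br x (br y z) + br y (br z x) + br z (br x y) = 0"
begin

lemma zero_left [simp]: "br 0 y = 0"
  using scale_left[of 0 0 y] by simp

lemma zero_right [simp]: "br y 0 = 0"
  using scale_right[of y 0 0] by simp

lemma antisym: "br y x = - br x y"
proof -
  have "br x y + br y x = br (x + y) (x + y)"
    by (simp only: add_left add_right) (simp add: alt)
  then have "br x y + br y x = 0" by (simp only: alt)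
  then show ?thesis by (simp add: eq_neg_iff_add_eq_0 add.commute)
qed

lemma minus_left: "br (- x) y = - br x y"
  using scale_left[of "-1" x y] by simp

lemma minus_right: "br x (- y) = - br x y"
  using scale_right[of x "-1" y] by simp

lemma diff_left: "br (x - y) z = br x z - br y z"
  using add_left[of x "- y" z] by (simp add: minus_left)

lemma diff_right: "br z (x - y) = br z x - br z y"
  using add_right[of z x "- y"] by (simp add: minus_right)

lemma leibniz: "br x (br y z) = br (br x y) z + br y (br x z)"
proof -
  have "br x (br y z) - br y (br x z) - br (br x y) z = 0"
    using jacobi[of x y z] antisym[of z x] antisym[of z "br x y"] by (simp add: minus_right)
  then show ?thesis by (simp add: algebra_simps)
qed

lemma brset_subspace: "cv.subspace (brset br A B)"
  by (simp add: brset_def)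

lemma brset_least:
  assumes "cv.subspace Z" "\<And>x y. x \<in> A \<Longrightarrow> y \<in> B \<Longrightarrow> br x y \<in> Z"
  shows "brset br A B \<subseteq> Z"
  unfolding brset_def using assms by (intro cv.span_minimal) auto

lemma brset_in: "x \<in> A \<Longrightarrow> y \<in> B \<Longrightarrow> br x y \<in> brset br A B"
  unfolding brset_def by (intro cv.span_base) auto

lemma brset_mono: "A \<subseteq> A' \<Longrightarrow> B \<subseteq> B' \<Longrightarrow> brset br A B \<subseteq> brset br A' B'"
  unfolding brset_def by (intro cv.span_mono) auto

lemma br_span_span:
  assumes "cv.subspace Z" "\<And>x y. x \<in> A \<Longrightarrow> y \<in> B \<Longrightarrow> br x y \<in> Z"
    "x \<in> cspan A" "y \<in> cspan B"
  shows "br x y \<in> Z"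
proof -
  have 1: "br x y \<in> Z" if "x \<in> A" for x
    using assms(4)
    by (induction rule: cv.span_induct_alt)
      (auto simp: add_right scale_right cv.subspace_0[OF assms(1)] assms(2) that
        intro!: cv.subspace_add[OF assms(1)] cv.subspace_scale[OF assms(1)])
  show ?thesis
    using assms(3)
    by (induction rule: cv.span_induct_alt)
      (auto simp: add_left scale_left cv.subspace_0[OF assms(1)] 1
        intro!: cv.subspace_add[OF assms(1)] cv.subspace_scale[OF assms(1)])
qed

lemma ds_mono: "X \<subseteq> Y \<Longrightarrow> derived_series br X n \<subseteq> derived_series br Y n"
  by (induction n) (simp_all add: derived_def brset_mono)

lemma ds_subspace: "cv.subspace X \<Longrightarrow> cv.subspace (derived_series br X n)"
  by (cases n) (auto simp: derived_def brset_subspace)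

lemma ds_add: "derived_series br X (n + k) = derived_series br (derived_series br X n) k"
  by (induction k) auto

lemma ds_subset:
  assumes "cv.subspace X" "\<And>x y. x \<in> X \<Longrightarrow> y \<in> X \<Longrightarrow> br x y \<in> X"
  shows "derived_series br X n \<subseteq> X"
proof (induction n)
  case (Suc n)
  then have "brset br (derived_series br X n) (derived_series br X n) \<subseteq> X"
    using assms by (intro brset_least) auto
  then show ?case by (simp add: derived_def)
qed auto

text \<open>Modulo Q, which P normalizes and which is closed under the bracket, every element of X
  is one of P; so the derived series of X follows that of P up to terms in Q.\<close>

lemma ds_sum:
  assumes Q: "cv.subspace Q" and P: "cv.subspace P"
    and PP: "\<And>x y. x \<in> P \<Longrightarrow> y \<in> P \<Longrightarrow> br x y \<in> P"
    and PQ: "\<And>x y. x \<in> P \<Longrightarrow> y \<in> Q \<Longrightarrow> br x y \<in> Q"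
    and QQ: "\<And>x y. x \<in> Q \<Longrightarrow> y \<in> Q \<Longrightarrow> br x y \<in> Q"
    and X: "X \<subseteq> {p + q | p q. p \<in> P \<and> q \<in> Q}"
  shows "derived_series br X n \<subseteq> {p + q | p q. p \<in> derived_series br P n \<and> q \<in> Q}"
proof (induction n)
  case 0
  then show ?case using X by simp
next
  case (Suc n)
  let ?D = "derived_series br P n"
  have D: "?D \<subseteq> P" using ds_subset[OF P PP] .
  have "brset br (derived_series br X n) (derived_series br X n)
      \<subseteq> {p + q | p q. p \<in> brset br ?D ?D \<and> q \<in> Q}"
  proof (rule brset_least)
    show "cv.subspace {p + q | p q. p \<in> brset br ?D ?D \<and> q \<in> Q}"
      by (intro cv.subspace_sums brset_subspace Q)
    fix x y assume "x \<in> derived_series br X n" "y \<in> derived_series br X n"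
    then obtain p q p' q' where pq: "x = p + q" "p \<in> ?D" "q \<in> Q" "y = p' + q'" "p' \<in> ?D" "q' \<in> Q"
      using Suc by blast
    have "br x y = br p p' + (br p q' + (br q p' + br q q'))"
      by (simp add: pq add_left add_right)
    moreover have "br q p' \<in> Q" using PQ[of p' q] pq D antisym[of q p'] Q cv.subspace_neg by auto
    then have "br p q' + (br q p' + br q q') \<in> Q"
      using PQ[of p q'] QQ[of q q'] pq D by (auto intro!: cv.subspace_add[OF Q])
    moreover have "br p p' \<in> brset br ?D ?D" using pq brset_in by blast
    ultimately show "br x y \<in> {p + q | p q. p \<in> brset br ?D ?D \<and> q \<in> Q}" by blast
  qed
  then show ?case by (simp add: derived_def)
qed

end

section \<open>Generalized eigenspaces of a derivation\<close>

locale lie_derivation = lie br for br :: "'a::complex_vector \<Rightarrow> 'a \<Rightarrow> 'a" +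
  fixes d :: "'a \<Rightarrow> 'a"
  assumes d_add: "d (x + y) = d x + d y"
    and d_scale: "d (c *\<^sub>C x) = c *\<^sub>C d x"
    and d_br: "d (br x y) = br (d x) y + br x (d y)"
begin

lemma d_0 [simp]: "d 0 = 0"
  using d_scale[of 0 0] by simp

lemma d_minus: "d (- x) = - d x"
  using d_scale[of "-1" x] by simp

lemma d_diff: "d (x - y) = d x - d y"
  using d_add[of x "- y"] by (simp add: d_minus)

lemma d_sum: "d (\<Sum>i\<in>A. f i) = (\<Sum>i\<in>A. d (f i))"
  by (induction A rule: infinite_finite_induct) (auto simp: d_add)

definition d_inv :: "'a set \<Rightarrow> bool" where
  "d_inv X \<longleftrightarrow> cv.subspace X \<and> (\<forall>x\<in>X. d x \<in> X)"

lemma d_invD: "d_inv X \<Longrightarrow> cv.subspace X" "d_inv X \<Longrightarrow> x \<in> X \<Longrightarrow> d x \<in> X"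
  by (auto simp: d_inv_def)

lemma d_inv_shift: "d_inv X \<Longrightarrow> x \<in> X \<Longrightarrow> d x - l *\<^sub>C x \<in> X"
  by (auto simp: d_inv_def intro: cv.subspace_diff cv.subspace_scale)

text \<open>The union over n of the kernels of (d - l)^n. As an inductive set it carries no
  exponent: rule induction is induction on the nilpotency order, which need not be bounded.\<close>

inductive_set geig :: "complex \<Rightarrow> 'a set" for l where
  zero: "0 \<in> geig l"
| step: "d x - l *\<^sub>C x \<in> geig l \<Longrightarrow> x \<in> geig l"

lemma geig_shift: "x \<in> geig l \<Longrightarrow> d x - l *\<^sub>C x \<in> geig l"
  by (induction rule: geig.cases) (auto intro: geig.zero)

lemma geig_add: "x \<in> geig l \<Longrightarrow> y \<in> geig l \<Longrightarrow> x + y \<in> geig l"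
proof (induction arbitrary: y rule: geig.induct)
  case (step x)
  have "d (x + y) - l *\<^sub>C (x + y) = (d x - l *\<^sub>C x) + (d y - l *\<^sub>C y)"
    by (simp add: d_add cv.scale_right_distrib)
  then show ?case using step.IH[OF geig_shift[OF step.prems]] by (metis geig.step)
qed auto

lemma geig_scale: "x \<in> geig l \<Longrightarrow> c *\<^sub>C x \<in> geig l"
proof (induction rule: geig.induct)
  case (step x)
  have "d (c *\<^sub>C x) - l *\<^sub>C (c *\<^sub>C x) = c *\<^sub>C (d x - l *\<^sub>C x)"
    by (simp add: d_scale cv.scale_right_diff_distrib mult.commute)
  then show ?case using step.IH by (metis geig.step)
qed (auto intro: geig.zero)

lemma geig_subspace: "cv.subspace (geig l)"
  by (intro cv.subspaceI geig.zero geig_add geig_scale)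

lemma geig_inv: "d_inv (geig l)"
proof -
  have "d x \<in> geig l" if "x \<in> geig l" for x
    using geig_add[OF geig_shift[OF that] geig_scale[OF that, of l]] by simp
  then show ?thesis by (simp add: d_inv_def geig_subspace)
qed

text \<open>The operator d - (l + m) obeys the Leibniz rule with d - l on the left factor and d - m
  on the right. Nested induction replaces the binomial expansion of its powers.\<close>

lemma geig_br: "x \<in> geig l \<Longrightarrow> y \<in> geig m \<Longrightarrow> br x y \<in> geig (l + m)"
proof (induction arbitrary: y rule: geig.induct)
  case (step x)
  note IH = step.IH
  show ?case
    using step.prems
  proof (induction rule: geig.induct)
    case (step y)
    have "d (br x y) - (l + m) *\<^sub>C br x y = br (d x - l *\<^sub>C x) y + br x (d y - m *\<^sub>C y)"
      by (simp add: d_br diff_left diff_right scale_left scale_right cv.scale_left_distrib)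
    moreover have "\<dots> \<in> geig (l + m)"
      by (rule geig_add[OF IH[OF geig.step[OF step.hyps]] step.IH])
    ultimately show ?case by (metis geig.step)
  qed (simp add: geig.zero)
qed (simp add: geig.zero)

text \<open>On this eigenspace d - l is the nonzero scalar m - l plus the locally nilpotent d - m,
  hence injective modulo X: (m - l) w is the difference of d w - l w and d w - m w, and the latter
  lies in X by induction.\<close>

lemma geig_cancel:
  assumes "w \<in> geig m" "d_inv X" "m \<noteq> l" "d w - l *\<^sub>C w \<in> X"
  shows "w \<in> X"
  using assms(1,4)
proof (induction rule: geig.induct)
  case zero
  then show ?case using d_invD[OF assms(2)] cv.subspace_0 by blast
next
  case (step w)
  define v where "v = d w - m *\<^sub>C w"
  have "d v - l *\<^sub>C v = d (d w - l *\<^sub>C w) - m *\<^sub>C (d w - l *\<^sub>C w)"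
    by (simp add: v_def d_diff d_scale cv.scale_right_diff_distrib mult.commute)
  then have "d v - l *\<^sub>C v \<in> X"
    using d_inv_shift[OF assms(2) step.prems] by simp
  then have "v \<in> X" using step.IH by (simp add: v_def)
  then have "(d w - l *\<^sub>C w) - v \<in> X"
    by (rule cv.subspace_diff[OF d_invD(1)[OF assms(2)] step.prems])
  then have "(m - l) *\<^sub>C w \<in> X"
    by (simp add: v_def cv.scale_left_diff_distrib)
  then have "inverse (m - l) *\<^sub>C ((m - l) *\<^sub>C w) \<in> X"
    using d_invD(1)[OF assms(2)] cv.subspace_scale by blast
  then show ?case using assms(3) by simp
qed

lemma geig_surj:
  assumes "v \<in> geig m" "m \<noteq> l"
  shows "\<exists>w\<in>geig m. d w - l *\<^sub>C w = v"
  using assms(1)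
proof (induction rule: geig.induct)
  case zero
  then show ?case by (intro bexI[of _ 0]) (auto intro: geig.zero)
next
  case (step v)
  then obtain w where w: "w \<in> geig m" "d w - l *\<^sub>C w = d v - m *\<^sub>C v" by blast
  \<comment> \<open>One step of the Neumann series for the inverse of (m - l) + (d - m).\<close>
  let ?u = "inverse (m - l) *\<^sub>C (v - w)"
  have "d ?u - l *\<^sub>C ?u = inverse (m - l) *\<^sub>C ((d v - l *\<^sub>C v) - (d w - l *\<^sub>C w))"
    by (simp add: d_diff d_scale cv.scale_right_diff_distrib mult.commute)
  also have "\<dots> = inverse (m - l) *\<^sub>C ((m - l) *\<^sub>C v)"
    by (simp add: w cv.scale_left_diff_distrib)
  also have "\<dots> = v" using assms(2) by simp
  finally have "d ?u - l *\<^sub>C ?u = v" .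
  moreover have "?u \<in> geig m"
    using geig.step[OF step.hyps] w by (intro geig_scale cv.subspace_diff geig_subspace)
  ultimately show ?case by blast
qed

text \<open>Applying d - n repeatedly removes the component \<open>f n\<close>. As d - n is
  injective modulo X on the other eigenspaces, the remaining components are in X if their images
  are.\<close>

lemma geig_component:
  assumes "finite K" "\<forall>m\<in>K. f m \<in> geig m" "d_inv X" "(\<Sum>m\<in>K. f m) \<in> X"
  shows "\<forall>m\<in>K. f m \<in> X"
  using assms(1,2,4)
proof (induction K arbitrary: f rule: finite_induct)
  case (insert n K)
  have *: "\<forall>m\<in>K. f m \<in> X" if "a \<in> geig n" "\<forall>m\<in>K. f m \<in> geig m" "a + (\<Sum>m\<in>K. f m) \<in> X" for a f
    using that
  proof (induction arbitrary: f rule: geig.induct)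
    case zero
    then show ?case using insert.IH by simp
  next
    case (step a)
    let ?f = "\<lambda>m. d (f m) - n *\<^sub>C f m"
    have "d (a + (\<Sum>m\<in>K. f m)) - n *\<^sub>C (a + (\<Sum>m\<in>K. f m)) = (d a - n *\<^sub>C a) + (\<Sum>m\<in>K. ?f m)"
      by (simp add: d_add d_sum cv.scale_right_distrib cv.scale_sum_right sum_subtractf)
    then have "(d a - n *\<^sub>C a) + (\<Sum>m\<in>K. ?f m) \<in> X"
      using d_inv_shift[OF assms(3) step.prems(2)] by metis
    moreover have "\<forall>m\<in>K. ?f m \<in> geig m"
      using step.prems(1) by (auto intro!: d_inv_shift[OF geig_inv])
    ultimately have "\<forall>m\<in>K. ?f m \<in> X" using step.IH[of ?f] by blast
    then show ?case
      using geig_cancel[OF _ assms(3)] step.prems(1) insert.hyps(2) by metis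
  qed
  have K: "\<forall>m\<in>K. f m \<in> X" using *[of "f n" f] insert by simp
  moreover have "f n = (\<Sum>m\<in>insert n K. f m) - (\<Sum>m\<in>K. f m)"
    using insert.hyps by simp
  then have "f n \<in> X"
    using d_invD(1)[OF assms(3)] insert.prems(2) K by (metis cv.subspace_diff cv.subspace_sum)
  ultimately show ?case by simp
qed simp

lemma geig_span_repr:
  assumes "x \<in> cspan (\<Union>m\<in>A. geig m)"
  obtains K f where "finite K" "K \<subseteq> A" "\<forall>m. f m \<in> geig m" "x = (\<Sum>m\<in>K. f m)"
proof -
  have "\<exists>K f. finite K \<and> K \<subseteq> A \<and> (\<forall>m. f m \<in> geig m) \<and> x = (\<Sum>m\<in>K. f m)"
    using assms
  proof (induction rule: cv.span_induct_alt)
    case base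
    show ?case by (intro exI[of _ "{}"] exI[of _ "\<lambda>_. 0"]) (auto intro: geig.zero)
  next
    case (step c x y)
    then obtain K f n where K: "finite K" "K \<subseteq> A" "\<forall>m. f m \<in> geig m" "y = (\<Sum>m\<in>K. f m)"
      and n: "n \<in> A" "x \<in> geig n" by blast
    let ?f = "\<lambda>m. if m \<in> K then f m else 0"
    let ?g = "?f(n := ?f n + c *\<^sub>C x)"
    have "\<forall>m. ?g m \<in> geig m" using K n by (auto intro: geig.zero geig_add geig_scale)
    moreover have "(\<Sum>m\<in>insert n K. ?g m) = c *\<^sub>C x + y"
    proof -
      have "y = (\<Sum>m\<in>K. ?f m)" using K by simp
      also have "\<dots> = (\<Sum>m\<in>insert n K. ?f m)" using K(1) by (auto simp: sum.insert_if insert_absorb)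
      also have "\<dots> = ?f n + (\<Sum>m\<in>insert n K - {n}. ?f m)" using K(1) by (subst sum.remove[of _ n]) auto
      finally have y: "y = ?f n + (\<Sum>m\<in>insert n K - {n}. ?f m)" .
      have "(\<Sum>m\<in>insert n K. ?g m) = ?g n + (\<Sum>m\<in>insert n K - {n}. ?g m)"
        using K(1) by (subst sum.remove[of _ n]) auto
      also have "(\<Sum>m\<in>insert n K - {n}. ?g m) = (\<Sum>m\<in>insert n K - {n}. ?f m)"
        by (rule sum.cong) auto
      finally show ?thesis using y by (simp add: algebra_simps)
    qed
    ultimately show ?case using K n by (intro exI[of _ "insert n K"] exI[of _ ?g]) auto
  qed
  then show thesis using that by blast
qed

definition gspace :: "'a set" where
  "gspace = cspan (\<Union>m. geig m)"

lemma geig_gspace: "geig m \<subseteq> gspace"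
  unfolding gspace_def using cv.span_superset by blast

text \<open>On \<open>gspace\<close>, d - l is onto up to \<open>geig l\<close>, since it is
  invertible on the other eigenspaces. So d w - l w agrees modulo \<open>geig l\<close> with the
  image of some u in \<open>gspace\<close>, and then u - w is itself in
  \<open>geig l\<close>.\<close>

lemma gspace_shift:
  assumes "d w - l *\<^sub>C w \<in> gspace"
  shows "w \<in> gspace"
proof -
  let ?S = "{v. \<exists>u\<in>gspace. d u - l *\<^sub>C u - v \<in> geig l}"
  have "v \<in> ?S" if "v \<in> gspace" for v
    using that unfolding gspace_def
  proof (induction rule: cv.span_induct_alt)
    case base
    then show ?case by (auto intro!: bexI[of _ 0] simp: geig.zero cv.span_zero)
  next
    case (step c x y)
    then obtain m u where x: "x \<in> geig m" and u: "u \<in> gspace" "d u - l *\<^sub>C u - y \<in> geig l"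
      by (auto simp: gspace_def)
    obtain u' where u': "u' \<in> gspace" "d u' - l *\<^sub>C u' - x \<in> geig l"
    proof (cases "m = l")
      case True
      have "- x \<in> geig l" using x True cv.subspace_neg[OF geig_subspace] by blast
      then show thesis using that[of 0] by (simp add: gspace_def cv.span_zero)
    next
      case False
      obtain u' where "u' \<in> geig m" "d u' - l *\<^sub>C u' = x"
        using geig_surj[OF x False] by blast
      then show thesis
        using that[of u'] geig_gspace by (auto simp: geig.zero)
    qed
    have eq: "d (c *\<^sub>C u' + u) - l *\<^sub>C (c *\<^sub>C u' + u) - (c *\<^sub>C x + y)
        = c *\<^sub>C (d u' - l *\<^sub>C u' - x) + (d u - l *\<^sub>C u - y)"
      by (simp add: d_add d_scale cv.scale_right_diff_distrib cv.scale_right_distrib mult.commute)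
    have "d (c *\<^sub>C u' + u) - l *\<^sub>C (c *\<^sub>C u' + u) - (c *\<^sub>C x + y) \<in> geig l"
      unfolding eq by (intro geig_add geig_scale u u')
    moreover have "c *\<^sub>C u' + u \<in> gspace"
      using u u' unfolding gspace_def by (intro cv.span_add cv.span_scale)
    ultimately show ?case by (auto simp: gspace_def)
  qed
  then obtain u where u: "u \<in> gspace" "d u - l *\<^sub>C u - (d w - l *\<^sub>C w) \<in> geig l"
    using assms by blast
  moreover have "d (u - w) - l *\<^sub>C (u - w) = d u - l *\<^sub>C u - (d w - l *\<^sub>C w)"
    by (simp add: d_diff cv.scale_right_diff_distrib)
  ultimately have "d (u - w) - l *\<^sub>C (u - w) \<in> geig l" by (simp only:)
  then have "u - w \<in> geig l" by (rule geig.step)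
  then have "u - w \<in> gspace" using geig_gspace by blast
  with u(1) have "u - (u - w) \<in> gspace"
    unfolding gspace_def by (rule cv.span_diff)
  moreover have "u - (u - w) = w" by simp
  ultimately show ?thesis by (simp only:)
qed

section \<open>Polynomials in the derivation\<close>

definition poly_op :: "complex poly \<Rightarrow> 'a \<Rightarrow> 'a" where
  "poly_op p w = (\<Sum>i\<le>degree p. coeff p i *\<^sub>C (d ^^ i) w)"

lemma poly_op_altdef: "degree p \<le> n \<Longrightarrow> poly_op p w = (\<Sum>i\<le>n. coeff p i *\<^sub>C (d ^^ i) w)"
  unfolding poly_op_def by (rule sum.mono_neutral_left) (auto intro: coeff_eq_0)

lemma poly_op_linear_factor: "poly_op ([:- l, 1:] * q) w = d (poly_op q w) - l *\<^sub>C poly_op q w"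
proof -
  let ?n = "degree q"
  have eq: "[:- l, 1:] * q = pCons 0 q - smult l q" by simp
  have c: "coeff ([:- l, 1:] * q) i = coeff (pCons 0 q) i - l * coeff q i" for i
    unfolding eq by simp
  have deg: "degree ([:- l, 1:] * q) \<le> Suc ?n"
    by (rule degree_mult_le[THEN order_trans]) simp
  have "poly_op ([:- l, 1:] * q) w = (\<Sum>i\<le>Suc ?n. (coeff (pCons 0 q) i - l * coeff q i) *\<^sub>C (d ^^ i) w)"
    using poly_op_altdef[OF deg] c by simp
  also have "\<dots> = (\<Sum>i\<le>Suc ?n. coeff (pCons 0 q) i *\<^sub>C (d ^^ i) w)
      - l *\<^sub>C (\<Sum>i\<le>Suc ?n. coeff q i *\<^sub>C (d ^^ i) w)"
    by (simp only: cv.scale_left_diff_distrib sum_subtractf cv.scale_sum_right cv.scale_scale)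
  also have "(\<Sum>i\<le>Suc ?n. coeff q i *\<^sub>C (d ^^ i) w) = poly_op q w"
    by (rule poly_op_altdef[symmetric]) simp
  also have "(\<Sum>i\<le>Suc ?n. coeff (pCons 0 q) i *\<^sub>C (d ^^ i) w) = d (poly_op q w)"
    by (simp only: sum.atMost_Suc_shift poly_op_def d_sum d_scale coeff_pCons_Suc coeff_pCons_0) simp
  finally show ?thesis .
qed

text \<open>Over the complex numbers p splits into linear factors, and \<open>gspace_shift\<close>
  cancels them one at a time.\<close>

lemma poly_op_gspace: "p \<noteq> 0 \<Longrightarrow> poly_op p w \<in> gspace \<Longrightarrow> w \<in> gspace"
proof (induction "degree p" arbitrary: p)
  case 0
  then obtain c where c: "p = [:c:]" "c \<noteq> 0" by (metis degree_eq_zeroE pCons_0_0)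
  then have "c *\<^sub>C w \<in> gspace" using 0 by (simp add: poly_op_def)
  then have "inverse c *\<^sub>C (c *\<^sub>C w) \<in> gspace" unfolding gspace_def by (rule cv.span_scale)
  then show ?case using c by simp
next
  case (Suc n)
  then have "\<not> constant (poly p)" by (simp add: constant_degree)
  then obtain l where "poly p l = 0" using fundamental_theorem_of_algebra by blast
  then obtain q where q: "p = [:- l, 1:] * q" by (auto simp: poly_eq_0_iff_dvd)
  then have "q \<noteq> 0" using Suc.prems by auto
  then have "degree p = Suc (degree q)" unfolding q by (subst degree_mult_eq) auto
  then show ?case
    using Suc.hyps(1)[of q] Suc.hyps(2) Suc.prems(2) \<open>q \<noteq> 0\<close> gspace_shift[of "poly_op q w" l]
    unfolding q poly_op_linear_factor by auto
qed

lemma finite_dim_gspace: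
  assumes "finite F" "U \<subseteq> cspan F" "d_inv U"
  shows "U \<subseteq> gspace"
proof
  fix w assume w: "w \<in> U"
  have wi: "(d ^^ i) w \<in> U" for i
    by (induction i) (use w d_invD(2)[OF assms(3)] in auto)
  obtain p where "p \<noteq> 0" "poly_op p w = 0"
  \<comment> \<open>Linear dependence is a property of sets of vectors, so a repetition among the
    iterates is treated apart: it gives the polynomial x^j - x^i. Without repetition, card F + 1
    iterates are dependent.\<close>
  proof (cases "inj (\<lambda>i. (d ^^ i) w)")
    case False
    then obtain i j where ij: "i < j" "(d ^^ i) w = (d ^^ j) w"
      unfolding inj_def by (metis linorder_neq_iff)
    let ?p = "monom 1 j - monom 1 i :: complex poly"
    have "degree ?p \<le> j" using ij by (intro degree_diff_le) (auto simp: degree_monom_eq)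
    then have "poly_op ?p w = (\<Sum>k\<le>j. coeff ?p k *\<^sub>C (d ^^ k) w)" by (rule poly_op_altdef)
    also have "\<dots> = (\<Sum>k\<le>j. (if k = j then (d ^^ k) w else 0)) - (\<Sum>k\<le>j. (if k = i then (d ^^ k) w else 0))"
      unfolding sum_subtractf[symmetric] by (rule sum.cong) (auto simp: cv.scale_left_diff_distrib)
    also have "\<dots> = 0" using ij by simp
    finally have "poly_op ?p w = 0" .
    moreover have "coeff ?p j \<noteq> 0" using ij by simp
    then have "?p \<noteq> 0" by (metis coeff_0)
    ultimately show thesis using that by blast
  next
    case True
    define N where "N = card F"
    let ?e = "\<lambda>i. (d ^^ i) w"
    have inj: "inj_on ?e {..N}" using True by (rule inj_on_subset) simp
    then have "card (?e ` {..N}) = Suc N" by (simp add: card_image)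
    moreover have "?e ` {..N} \<subseteq> cspan F" using wi assms(2) by blast
    ultimately have "cv.dependent (?e ` {..N})"
      using cv.independent_span_bound[OF assms(1)] N_def by fastforce
    then obtain u v where u: "v \<in> ?e ` {..N}" "u v \<noteq> 0" "(\<Sum>v\<in>?e ` {..N}. u v *\<^sub>C v) = 0"
      using cv.dependent_finite[of "?e ` {..N}"] by auto
    have rel: "(\<Sum>i\<le>N. u (?e i) *\<^sub>C ?e i) = 0"
      using u(3) by (simp only: sum.reindex[OF inj] o_def)
    define p where "p = (\<Sum>i\<le>N. monom (u (?e i)) i)"
    have cp: "coeff p k = (if k \<le> N then u (?e k) else 0)" for k
      unfolding p_def by (simp add: coeff_sum)
    then have "degree p \<le> N" by (intro degree_le) auto
    then have "poly_op p w = (\<Sum>i\<le>N. coeff p i *\<^sub>C ?e i)" by (rule poly_op_altdef)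
    also have "\<dots> = (\<Sum>i\<le>N. u (?e i) *\<^sub>C ?e i)" by (rule sum.cong) (auto simp: cp)
    finally have "poly_op p w = 0" using rel by simp
    moreover have "p \<noteq> 0" using u(1,2) cp by (metis (no_types, lifting) atMost_iff coeff_0 imageE)
    ultimately show thesis using that by blast
  qed
  then show "w \<in> gspace" using poly_op_gspace[of p w] by (simp add: gspace_def cv.span_zero)
qed

end

section \<open>Limits of subspaces along the flow of a derivation\<close>

text \<open>A total order on the complex numbers compatible with addition: it plays the role of the generic
  direction in which the flow of a derivation is followed.\<close>

definition clt :: "complex \<Rightarrow> complex \<Rightarrow> bool" where
  "clt a b \<longleftrightarrow> Re a < Re b \<or> Re a = Re b \<and> Im a < Im b"

lemma clt_irrefl: "\<not> clt a a"
  by (simp add: clt_def)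

lemma clt_trans: "clt a b \<Longrightarrow> clt b c \<Longrightarrow> clt a c"
  by (auto simp: clt_def)

lemma clt_total: "a \<noteq> b \<Longrightarrow> clt a b \<or> clt b a"
  by (auto simp: clt_def complex_eq_iff)

lemma clt_add_right: "clt a b \<Longrightarrow> clt (a + c) (b + c)"
  by (auto simp: clt_def)

lemma clt_add_left: "clt a b \<Longrightarrow> clt (c + a) (c + b)"
  by (auto simp: clt_def)

lemma clt_maximum:
  assumes "finite K" "K \<noteq> {}"
  obtains m where "m \<in> K" "\<And>n. n \<in> K \<Longrightarrow> n \<noteq> m \<Longrightarrow> clt n m"
proof -
  have "\<exists>m\<in>K. \<forall>n\<in>K. n \<noteq> m \<longrightarrow> clt n m"
    using assms
  proof (induction K rule: finite_ne_induct)
    case (insert x K)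
    then obtain m where m: "m \<in> K" "\<forall>n\<in>K. n \<noteq> m \<longrightarrow> clt n m" by blast
    show ?case
    proof (cases "clt x m")
      case True
      then show ?thesis using m by (intro bexI[of _ m]) auto
    next
      case False
      then have "clt m x" using clt_total[of x m] m(1) insert.hyps by metis
      then have "\<forall>n\<in>K. clt n x" using m(2) clt_trans by metis
      then show ?thesis by (intro bexI[of _ x]) auto
    qed
  qed auto
  then show thesis using that by blast
qed

section \<open>Leading terms: the limit along the semisimple part\<close>

context lie_derivation
begin

text \<open>\<open>gr X\<close> consists of the leading terms of elements of \<open>X\<close> with respect to the generalized
  eigenspaces of \<open>d\<close>: the limit of $X$ under the flow of the semisimple part of \<open>d\<close>.\<close>

definition low :: "complex \<Rightarrow> 'a set" where
  "low m = cspan (\<Union>n\<in>{n. clt n m}. geig n)"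

definition gr :: "'a set \<Rightarrow> 'a set" where
  "gr X = cspan {w. \<exists>m. w \<in> geig m \<and> (\<exists>r\<in>low m. w + r \<in> X)}"

lemma gr_subspace: "cv.subspace (gr X)"
  by (simp add: gr_def)

lemma gr_mono: "X \<subseteq> Y \<Longrightarrow> gr X \<subseteq> gr Y"
  unfolding gr_def by (intro cv.span_mono) blast

lemma low_subspace: "cv.subspace (low m)"
  by (simp add: low_def)

lemma geig_low: "clt n m \<Longrightarrow> geig n \<subseteq> low m"
  unfolding low_def by (rule order_trans[OF _ cv.span_superset]) blast

lemma geig_low_br:
  assumes "x \<in> geig m" "r \<in> low n"
  shows "br x r \<in> low (m + n)"
proof (rule br_span_span[OF low_subspace, of "{x}" "\<Union>k\<in>{k. clt k n}. geig k"])
  show "r \<in> cspan (\<Union>k\<in>{k. clt k n}. geig k)" using assms(2) by (simp add: low_def)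
  show "x \<in> cspan {x}" by (simp add: cv.span_base)
  fix x' y assume "x' \<in> {x}" "y \<in> (\<Union>k\<in>{k. clt k n}. geig k)"
  then obtain k where "clt k n" "y \<in> geig k" "x' = x" by blast
  then have "br x' y \<in> geig (m + k)" "clt (m + k) (m + n)"
    using geig_br[OF assms(1)] clt_add_left by auto
  then show "br x' y \<in> low (m + n)" using geig_low by blast
qed

lemma low_geig_br:
  assumes "x \<in> geig m" "r \<in> low n"
  shows "br r x \<in> low (n + m)"
  using geig_low_br[OF assms] antisym[of r x] cv.subspace_neg[OF low_subspace] by (simp add: add.commute)

lemma low_low_br:
  assumes "x \<in> low m" "r \<in> low n"
  shows "br x r \<in> low (m + n)"
proof (rule br_span_span[OF low_subspace])
  show "x \<in> cspan (\<Union>k\<in>{k. clt k m}. geig k)" "r \<in> cspan (\<Union>k\<in>{k. clt k n}. geig k)"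
    using assms by (simp_all add: low_def)
  fix x y assume "x \<in> (\<Union>k\<in>{k. clt k m}. geig k)" "y \<in> (\<Union>k\<in>{k. clt k n}. geig k)"
  then obtain k l where "clt k m" "x \<in> geig k" "clt l n" "y \<in> geig l" by blast
  then have "clt (k + l) (m + n)" "br x y \<in> geig (k + l)"
    using clt_add_right[of k m l] clt_add_left[of l n m] clt_trans geig_br by blast+
  then show "br x y \<in> low (m + n)" using geig_low by blast
qed

text \<open>The order is compatible with addition, so in the bracket of x + r and y + s the term
  [x, y] has the highest weight and the other three are lower.\<close>

lemma gr_br:
  assumes "x \<in> gr X" "y \<in> gr Y"
  shows "br x y \<in> gr (brset br X Y)"
proof (rule br_span_span[OF gr_subspace, OF _ assms[unfolded gr_def]])
  fix x y
  assume "x \<in> {w. \<exists>m. w \<in> geig m \<and> (\<exists>r\<in>low m. w + r \<in> X)}"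
    and "y \<in> {w. \<exists>m. w \<in> geig m \<and> (\<exists>r\<in>low m. w + r \<in> Y)}"
  then obtain m r n s where x: "x \<in> geig m" "r \<in> low m" "x + r \<in> X"
    and y: "y \<in> geig n" "s \<in> low n" "y + s \<in> Y" by blast
  have "br (x + r) (y + s) = br x y + (br x s + (br r y + br r s))"
    by (simp add: add_left add_right algebra_simps)
  then have "br x y + (br x s + (br r y + br r s)) \<in> brset br X Y"
    using brset_in[OF x(3) y(3)] by simp
  moreover have "br x s + (br r y + br r s) \<in> low (m + n)"
    using geig_low_br[OF x(1) y(2)] low_geig_br[OF y(1) x(2)] low_low_br[OF x(2) y(2)]
    by (intro cv.subspace_add[OF low_subspace])
  moreover have "br x y \<in> geig (m + n)" using x y geig_br by blast
  ultimately show "br x y \<in> gr (brset br X Y)"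
    unfolding gr_def by (intro cv.span_base) blast
qed

lemma low_component:
  assumes "d_inv X" "w \<in> geig m" "r \<in> low m" "w + r \<in> X"
  shows "w \<in> X"
proof -
  obtain K f where K: "finite K" "K \<subseteq> {n. clt n m}" "\<forall>n. f n \<in> geig n" "r = (\<Sum>n\<in>K. f n)"
    using geig_span_repr assms(3) unfolding low_def by blast
  have "m \<notin> K" using K(2) clt_irrefl by blast
  let ?f = "f(m := w)"
  have "(\<Sum>n\<in>K. ?f n) = r" unfolding K(4) by (rule sum.cong) (use \<open>m \<notin> K\<close> in auto)
  then have "(\<Sum>n\<in>insert m K. ?f n) = w + r" using \<open>m \<notin> K\<close> K(1) by simp
  then show ?thesis
    using geig_component[of "insert m K" ?f X] K assms by auto
qed

lemma gr_inv:
  assumes "d_inv X" "X \<subseteq> gspace"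
  shows "gr X = X"
proof
  show "gr X \<subseteq> X"
    unfolding gr_def using low_component[OF assms(1)] d_invD(1)[OF assms(1)]
    by (intro cv.span_minimal) blast+
  show "X \<subseteq> gr X"
  proof
    fix x assume x: "x \<in> X"
    then obtain K f where K: "finite K" "\<forall>n. f n \<in> geig n" "x = (\<Sum>n\<in>K. f n)"
      using geig_span_repr[of x UNIV] assms(2) unfolding gspace_def by auto
    then have "\<forall>n\<in>K. f n \<in> X" using geig_component[of K f X] assms(1) x by simp
    have "f n \<in> gr X" if "n \<in> K" for n
    proof -
      have "f n + 0 \<in> X" using \<open>\<forall>n\<in>K. f n \<in> X\<close> that by simp
      then show ?thesis
        unfolding gr_def using K(2) cv.subspace_0[OF low_subspace] by (intro cv.span_base) blast
    qed
    then show "x \<in> gr X" unfolding K(3) using gr_subspace by (intro cv.subspace_sum) auto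
  qed
qed

text \<open>The leading term of an element of X lies in E, hence in X; subtracting it leaves an
  element of X with fewer components. By induction the element is a sum of elements of E.\<close>

lemma gr_reverse:
  assumes "cv.subspace X" "X \<subseteq> gspace" "cv.subspace E" "gr X \<subseteq> E" "E \<subseteq> X"
  shows "X \<subseteq> E"
proof
  have *: "(\<Sum>n\<in>K. f n) \<in> E" if "finite K" "\<forall>n. f n \<in> geig n" "(\<Sum>n\<in>K. f n) \<in> X" for K f
    using that
  proof (induction "card K" arbitrary: K)
    case 0
    then show ?case using cv.subspace_0[OF assms(3)] by simp
  next
    case (Suc c)
    then have "K \<noteq> {}" by auto
    then obtain m where m: "m \<in> K" "\<And>n. n \<in> K \<Longrightarrow> n \<noteq> m \<Longrightarrow> clt n m"
      using clt_maximum[OF Suc.prems(1)] by metis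
    have s: "(\<Sum>n\<in>K. f n) = f m + (\<Sum>n\<in>K-{m}. f n)"
      using Suc.prems(1) m(1) by (rule sum.remove)
    have "f n \<in> low m" if "n \<in> K - {m}" for n
      using geig_low[OF m(2)] Suc.prems(2) that by auto
    then have "(\<Sum>n\<in>K-{m}. f n) \<in> low m"
      by (rule cv.subspace_sum[OF low_subspace])
    moreover have "f m + (\<Sum>n\<in>K-{m}. f n) \<in> X" using s Suc.prems(3) by simp
    ultimately have "f m \<in> gr X"
      unfolding gr_def using Suc.prems(2) by (intro cv.span_base) blast
    then have fm: "f m \<in> E" using assms(4) by blast
    have "(\<Sum>n\<in>K-{m}. f n) = (\<Sum>n\<in>K. f n) - f m" using s by simp
    then have "(\<Sum>n\<in>K-{m}. f n) \<in> X"
      using cv.subspace_diff[OF assms(1) Suc.prems(3)] fm assms(5) by auto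
    then have "(\<Sum>n\<in>K-{m}. f n) \<in> E"
      using Suc.hyps(1)[of "K - {m}"] Suc.hyps(2) Suc.prems(1,2) m(1) by auto
    then show ?case unfolding s using fm by (intro cv.subspace_add[OF assms(3)])
  qed
  fix x assume "x \<in> X"
  then obtain K f where "finite K" "\<forall>n. f n \<in> geig n" "x = (\<Sum>n\<in>K. f n)"
    using geig_span_repr[of x UNIV] assms(2) unfolding gspace_def by auto
  then show "x \<in> E" using *[of K f] \<open>x \<in> X\<close> by simp
qed

section \<open>Graded subspaces and the limit along the nilpotent part\<close>

definition graded :: "'a set \<Rightarrow> bool" where
  "graded X \<longleftrightarrow> cv.subspace X \<and> X \<subseteq> cspan (\<Union>m. X \<inter> geig m)"

lemma gr_graded: "graded (gr X)"
proof -
  let ?W = "{w. \<exists>m. w \<in> geig m \<and> (\<exists>r\<in>low m. w + r \<in> X)}"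
  have "?W \<subseteq> gr X" unfolding gr_def by (rule cv.span_superset)
  then have "?W \<subseteq> (\<Union>m. gr X \<inter> geig m)" by blast
  then have "cspan ?W \<subseteq> cspan (\<Union>m. gr X \<inter> geig m)" by (rule cv.span_mono)
  then have "gr X \<subseteq> cspan (\<Union>m. gr X \<inter> geig m)" by (simp only: gr_def[of X, symmetric])
  then show ?thesis by (simp add: graded_def gr_subspace)
qed

text \<open>A sequence \<open>P\<close> stands for the polynomial curve $\sum_i t^i P_i$ in the generalized eigenspace for
  \<open>m\<close>, where $N = d - m$ is nilpotent. Since \<open>nab m\<close> is $e^{tN} \circ \frac{d}{dt} \circ e^{-tN}$,
  the values at $t = 0$ of its iterates on \<open>P\<close> are the derivatives at $t = 0$ of $e^{-tN} P$. So
  \<open>curve m X k P\<close> says that \<open>P\<close> has degree at most \<open>k\<close> and $P(t) \in e^{tN} X$ for all $t$; its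
  top coefficient then lies in the limit of $e^{tN} X$.\<close>

definition nab :: "complex \<Rightarrow> (nat \<Rightarrow> 'a) \<Rightarrow> nat \<Rightarrow> 'a" where
  "nab m P = (\<lambda>i. of_nat (Suc i) *\<^sub>C P (Suc i) - (d (P i) - m *\<^sub>C P i))"

definition curve :: "complex \<Rightarrow> 'a set \<Rightarrow> nat \<Rightarrow> (nat \<Rightarrow> 'a) \<Rightarrow> bool" where
  "curve m X k P \<longleftrightarrow> (\<forall>i. P i \<in> geig m) \<and> (\<forall>i>k. P i = 0) \<and> (\<forall>j. (nab m ^^ j) P 0 \<in> X)"

definition plim :: "'a set \<Rightarrow> 'a set" where
  "plim X = cspan {w. \<exists>m k P. curve m X k P \<and> w = P k}"

lemma plim_subspace: "cv.subspace (plim X)"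
  by (simp add: plim_def)

lemma plim_top: "curve m X k P \<Longrightarrow> P k \<in> plim X"
  unfolding plim_def by (rule cv.span_base) blast

lemma plim_mono: "X \<subseteq> Y \<Longrightarrow> plim X \<subseteq> plim Y"
  unfolding plim_def curve_def by (intro cv.span_mono) blast

lemma nab_add: "nab m (\<lambda>i. P i + Q i) = (\<lambda>i. nab m P i + nab m Q i)"
  by (rule ext) (simp add: nab_def d_add cv.scale_right_distrib algebra_simps)

lemma nab_pow_add: "(nab m ^^ j) (\<lambda>i. P i + Q i) = (\<lambda>i. (nab m ^^ j) P i + (nab m ^^ j) Q i)"
  by (induction j) (simp_all add: nab_add)

lemma nab_diff: "nab m (\<lambda>i. P i - Q i) = (\<lambda>i. nab m P i - nab m Q i)"
  by (rule ext) (simp add: nab_def d_diff cv.scale_right_diff_distrib algebra_simps)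

lemma nab_pow_diff: "(nab m ^^ j) (\<lambda>i. P i - Q i) = (\<lambda>i. (nab m ^^ j) P i - (nab m ^^ j) Q i)"
  by (induction j) (simp_all add: nab_diff)

lemma nab_in:
  assumes "d_inv X" "\<forall>i. P i \<in> X"
  shows "nab m P i \<in> X"
  unfolding nab_def using assms d_invD(1)[OF assms(1)]
  by (intro cv.subspace_diff cv.subspace_scale d_inv_shift) auto

lemma nab_pow_in:
  assumes "d_inv X" "\<forall>i. P i \<in> X"
  shows "(nab m ^^ j) P i \<in> X"
  using assms(2) by (induction j arbitrary: i) (auto intro: nab_in[OF assms(1)])

lemma nab_pow_nab: "(nab m ^^ j) (nab m P) = (nab m ^^ Suc j) P"
  by (simp only: funpow_Suc_right o_apply)

lemma curve_nab:
  assumes "curve m X k P"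
  shows "curve m X k (nab m P)"
  unfolding curve_def
proof (intro conjI allI impI)
  show "nab m P i \<in> geig m" for i
    using assms by (intro nab_in[OF geig_inv]) (simp add: curve_def)
  show "nab m P i = 0" if "i > k" for i
    using assms that by (simp add: curve_def nab_def)
  show "(nab m ^^ j) (nab m P) 0 \<in> X" for j
    using assms unfolding nab_pow_nab curve_def by blast
qed

text \<open>The recursion (n + 1) P(n + 1) = \<open>nab m P n\<close> + (d - m) P(n) recovers the
  coefficients from the derivatives at 0; when X is d-stable it never leaves X.\<close>

lemma nab_pow_inv:
  assumes "d_inv X" "\<forall>j. (nab m ^^ j) P 0 \<in> X"
  shows "P n \<in> X"
  using assms(2)
proof (induction n arbitrary: P)
  case 0
  from 0[rule_format, of 0] show ?case by simp
next
  case (Suc n)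
  have "\<forall>j. (nab m ^^ j) (nab m P) 0 \<in> X"
    using Suc.prems by (metis funpow_Suc_right o_apply)
  then have "nab m P n \<in> X" by (rule Suc.IH)
  moreover have "d (P n) - m *\<^sub>C P n \<in> X" using Suc by (intro d_inv_shift[OF assms(1)])
  ultimately have "nab m P n + (d (P n) - m *\<^sub>C P n) \<in> X"
    using d_invD(1)[OF assms(1)] by (intro cv.subspace_add)
  then have "of_nat (Suc n) *\<^sub>C P (Suc n) \<in> X" by (simp add: nab_def)
  then have "inverse (of_nat (Suc n)) *\<^sub>C (of_nat (Suc n) *\<^sub>C P (Suc n)) \<in> X"
    by (rule cv.subspace_scale[OF d_invD(1)[OF assms(1)]])
  then show ?case by (simp del: of_nat_Suc)
qed

text \<open>At the top index the term with P(k + 1) vanishes, so \<open>nab m P k\<close> is -(d -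
  m) P(k). As \<open>nab\<close> maps curves to curves with the same degree bound, (d - m) P(k) is
  again in the limit, even if X is not d-stable.\<close>

lemma plim_d: "x \<in> plim X \<Longrightarrow> d x \<in> plim X"
  unfolding plim_def
proof (induction rule: cv.span_induct_alt)
  case base
  show ?case by (simp add: cv.span_zero)
next
  case (step c x y)
  then obtain m k P where P: "curve m X k P" "x = P k" by blast
  have "nab m P k \<in> plim X" by (rule plim_top[OF curve_nab[OF P(1)]])
  moreover have "nab m P k = - (d x - m *\<^sub>C x)"
    using P by (simp add: nab_def curve_def)
  then have "d x = m *\<^sub>C x - nab m P k" by simp
  moreover have "x \<in> plim X" using plim_top[OF P(1)] P(2) by simp
  ultimately have "d x \<in> plim X"
    by (simp only:) (intro cv.subspace_diff cv.subspace_scale plim_subspace)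
  then show ?case using step.IH by (simp add: d_add d_scale plim_def cv.span_add cv.span_scale)
qed

lemma plim_inv: "d_inv (plim X)"
  by (simp add: d_inv_def plim_subspace plim_d)

lemma d_inv_graded:
  assumes "d_inv X" "X \<subseteq> gspace"
  shows "graded X"
  using gr_graded[of X] gr_inv[OF assms] by simp

lemma plim_of_inv:
  assumes "d_inv X" "graded X"
  shows "plim X = X"
proof
  show "plim X \<subseteq> X"
    unfolding plim_def using nab_pow_inv[OF assms(1)] d_invD(1)[OF assms(1)]
    by (intro cv.span_minimal) (auto simp: curve_def)
  have "w \<in> plim X" if "w \<in> X" "w \<in> geig m" for w m
  proof -
    have "curve m X 0 (\<lambda>i. if i = 0 then w else 0)"
      unfolding curve_def using that cv.subspace_0[OF d_invD(1)[OF assms(1)]]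
      by (auto intro!: nab_pow_in[OF assms(1)] geig.zero)
    from plim_top[OF this] show ?thesis by simp
  qed
  then have "cspan (\<Union>m. X \<inter> geig m) \<subseteq> plim X"
    by (intro cv.span_minimal plim_subspace) auto
  then show "X \<subseteq> plim X" using assms(2) by (auto simp: graded_def)
qed

text \<open>The Cauchy product: the coefficients of the curve [P(t), Q(t)].\<close>

definition pbr :: "(nat \<Rightarrow> 'a) \<Rightarrow> (nat \<Rightarrow> 'a) \<Rightarrow> nat \<Rightarrow> 'a" where
  "pbr P Q = (\<lambda>n. \<Sum>i\<le>n. br (P i) (Q (n - i)))"

text \<open>Both d/dt and d obey the Leibniz rule, and the eigenvalues of the factors add; so
  \<open>nab\<close> is a derivation for this product.\<close>

lemma nab_pbr: "nab (l + m) (pbr P Q) = (\<lambda>i. pbr (nab l P) Q i + pbr P (nab m Q) i)"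
proof
  fix n
  have 1: "(\<Sum>i\<le>Suc n. of_nat i *\<^sub>C br (P i) (Q (Suc n - i)))
      = (\<Sum>i\<le>n. br (of_nat (Suc i) *\<^sub>C P (Suc i)) (Q (n - i)))"
    unfolding sum.atMost_Suc_shift by (simp add: scale_left)
  have 2: "(\<Sum>i\<le>Suc n. of_nat (Suc n - i) *\<^sub>C br (P i) (Q (Suc n - i)))
      = (\<Sum>i\<le>n. br (P i) (of_nat (Suc (n - i)) *\<^sub>C Q (Suc (n - i))))"
    unfolding sum.atMost_Suc by (simp add: scale_right Suc_diff_le)
  have "of_nat (Suc n) *\<^sub>C (\<Sum>i\<le>Suc n. br (P i) (Q (Suc n - i)))
      = (\<Sum>i\<le>Suc n. of_nat i *\<^sub>C br (P i) (Q (Suc n - i)) + of_nat (Suc n - i) *\<^sub>C br (P i) (Q (Suc n - i)))"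
    unfolding cv.scale_sum_right
    by (rule sum.cong) (auto simp: of_nat_diff simp flip: cv.scale_left_distrib)
  then have A: "of_nat (Suc n) *\<^sub>C pbr P Q (Suc n)
      = (\<Sum>i\<le>n. br (of_nat (Suc i) *\<^sub>C P (Suc i)) (Q (n - i)))
      + (\<Sum>i\<le>n. br (P i) (of_nat (Suc (n - i)) *\<^sub>C Q (Suc (n - i))))"
    unfolding pbr_def sum.distrib 1 2 .
  have B: "d (pbr P Q n) - (l + m) *\<^sub>C pbr P Q n
      = (\<Sum>i\<le>n. br (d (P i) - l *\<^sub>C P i) (Q (n - i))) + (\<Sum>i\<le>n. br (P i) (d (Q (n - i)) - m *\<^sub>C Q (n - i)))"
    unfolding pbr_def d_sum cv.scale_sum_right sum.distrib[symmetric] sum_subtractf[symmetric]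
    by (rule sum.cong) (auto simp: d_br diff_left diff_right scale_left scale_right cv.scale_left_distrib)
  show "nab (l + m) (pbr P Q) n = pbr (nab l P) Q n + pbr P (nab m Q) n"
    unfolding nab_def[of "l + m"] A B
    unfolding pbr_def nab_def diff_left diff_right sum_subtractf by simp
qed

lemma nab_pow_pbr:
  assumes "cv.subspace Z" "\<And>x y. x \<in> X \<Longrightarrow> y \<in> Y \<Longrightarrow> br x y \<in> Z"
    "\<forall>j. (nab l ^^ j) P 0 \<in> X" "\<forall>j. (nab m ^^ j) Q 0 \<in> Y"
  shows "(nab (l + m) ^^ j) (pbr P Q) 0 \<in> Z"
  using assms(3,4)
proof (induction j arbitrary: P Q)
  case 0
  from 0(1)[rule_format, of 0] 0(2)[rule_format, of 0] show ?case by (simp add: pbr_def assms(2))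
next
  case (Suc j)
  have P: "\<forall>j. (nab l ^^ j) (nab l P) 0 \<in> X" and Q: "\<forall>j. (nab m ^^ j) (nab m Q) 0 \<in> Y"
    using Suc.prems by (metis funpow_Suc_right o_apply)+
  have "(nab (l + m) ^^ Suc j) (pbr P Q) 0
      = (nab (l + m) ^^ j) (pbr (nab l P) Q) 0 + (nab (l + m) ^^ j) (pbr P (nab m Q)) 0"
    by (simp only: funpow_Suc_right o_apply nab_pbr nab_pow_add)
  then show ?case
    using Suc.IH[OF P Suc.prems(2)] Suc.IH[OF Suc.prems(1) Q] cv.subspace_add[OF assms(1)] by simp
qed

text \<open>The curve [P(t), Q(t)] has [P(k), Q(k')] as its coefficient of degree k + k'. This
  bracket may vanish, which is why \<open>curve\<close> only bounds the degree.\<close>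

lemma plim_br:
  assumes "x \<in> plim X" "y \<in> plim Y"
  shows "br x y \<in> plim (brset br X Y)"
proof (rule br_span_span[OF plim_subspace, OF _ assms[unfolded plim_def]])
  fix x y
  assume "x \<in> {w. \<exists>m k P. curve m X k P \<and> w = P k}" "y \<in> {w. \<exists>m k P. curve m Y k P \<and> w = P k}"
  then obtain l k P m k' Q where P: "curve l X k P" "x = P k" and Q: "curve m Y k' Q" "y = Q k'"
    by blast
  have z: "br (P i) (Q j) = 0" if "i + j \<ge> k + k'" "i \<noteq> k \<or> j \<noteq> k'" for i j
  proof -
    have "i > k \<or> j > k'" using that by linarith
    then show ?thesis using P(1) Q(1) by (auto simp: curve_def)
  qed
  have "pbr P Q i \<in> geig (l + m)" for i
    unfolding pbr_def using P Q by (intro cv.subspace_sum geig_subspace geig_br) (auto simp: curve_def)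
  moreover have "pbr P Q i = 0" if "i > k + k'" for i
    unfolding pbr_def using that by (intro sum.neutral ballI z) auto
  moreover have "(nab (l + m) ^^ j) (pbr P Q) 0 \<in> brset br X Y" for j
    using P Q by (intro nab_pow_pbr[OF brset_subspace brset_in]) (auto simp: curve_def)
  ultimately have "curve (l + m) (brset br X Y) (k + k') (pbr P Q)"
    by (auto simp: curve_def)
  then have "pbr P Q (k + k') \<in> plim (brset br X Y)" by (rule plim_top)
  moreover have "pbr P Q (k + k') = br x y"
  proof -
    have "pbr P Q (k + k') = (\<Sum>i\<in>{k}. br (P i) (Q (k + k' - i)))"
      unfolding pbr_def by (rule sum.mono_neutral_right) (auto intro!: z)
    then show ?thesis using P Q by simp
  qed
  ultimately show "br x y \<in> plim (brset br X Y)" by simp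
qed

text \<open>Top coefficients lie in E. The iterates under \<open>nab\<close> of the top monomial
  stay in E, hence in X, so subtracting it leaves a curve of lower degree; thus all coefficients of
  all curves lie in E. Every homogeneous w in X is the value at 0 of the curve e^(tN) w with N = d -
  m.\<close>

lemma plim_reverse:
  assumes "graded X" "d_inv E" "plim X \<subseteq> E" "E \<subseteq> X"
  shows "X \<subseteq> E"
proof -
  have X: "cv.subspace X" using assms(1) by (simp add: graded_def)
  have *: "P i \<in> E" if "curve m X k P" for m k P i
    using that
  proof (induction k arbitrary: P i)
    case 0
    then have "P 0 \<in> plim X" by (rule plim_top)
    moreover have "i > 0 \<Longrightarrow> P i = 0" using 0 by (auto simp: curve_def)
    ultimately show ?case using assms(3) cv.subspace_0[OF d_invD(1)[OF assms(2)]] by (cases "i = 0") auto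
  next
    case (Suc k)
    have "P (Suc k) \<in> plim X" by (rule plim_top[OF Suc.prems])
    then have top: "P (Suc k) \<in> E" using assms(3) by blast
    let ?R = "\<lambda>i. if i = Suc k then P (Suc k) else 0"
    have R: "\<forall>i. ?R i \<in> E" using top cv.subspace_0[OF d_invD(1)[OF assms(2)]] by simp
    have "curve m X k (\<lambda>i. P i - ?R i)"
      unfolding curve_def
    proof (intro conjI allI impI)
      show "P i - ?R i \<in> geig m" for i
        using Suc.prems by (auto simp: curve_def geig.zero)
      show "P i - ?R i = 0" if "i > k" for i
        using Suc.prems that by (auto simp: curve_def)
      show "(nab m ^^ j) (\<lambda>i. P i - ?R i) 0 \<in> X" for j
        unfolding nab_pow_diff using nab_pow_in[OF assms(2) R] assms(4) Suc.prems
        by (intro cv.subspace_diff[OF X]) (auto simp: curve_def)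
    qed
    then have "P i - ?R i \<in> E" by (rule Suc.IH)
    then have "(P i - ?R i) + ?R i \<in> E" using R by (intro cv.subspace_add[OF d_invD(1)[OF assms(2)]]) auto
    then show ?case by simp
  qed
  have "w \<in> E" if "w \<in> X" "w \<in> geig m" for w m
  proof -
    define N where "N = (\<lambda>x. d x - m *\<^sub>C x)"
    have N0: "N 0 = 0" by (simp add: N_def)
    have Ng: "(N ^^ i) w \<in> geig m" for i
      by (induction i) (use that(2) geig_shift in \<open>auto simp: N_def\<close>)
    have "\<exists>k. (N ^^ k) w = 0"
      using that(2)
    proof (induction rule: geig.induct)
      case zero
      show ?case by (intro exI[of _ 0]) simp
    next
      case (step x)
      then obtain k where "(N ^^ k) (N x) = 0" by (auto simp: N_def)
      then show ?case by (intro exI[of _ "Suc k"]) (simp only: funpow_Suc_right o_apply)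
    qed
    then obtain k where k: "(N ^^ k) w = 0" ..
    have k': "(N ^^ i) w = 0" if "i \<ge> k" for i
      using that by (induction rule: dec_induct) (simp_all add: k N0)
    \<comment> \<open>The Taylor coefficients of e^(tN) w. \<open>nab\<close> annihilates this
      curve, because e^(-tN) makes it constant.\<close>
    define P where "P = (\<lambda>i. inverse (fact i) *\<^sub>C (N ^^ i) w)"
    have N_scale: "N (c *\<^sub>C x) = c *\<^sub>C N x" for c x
      by (simp add: N_def d_scale cv.scale_right_diff_distrib mult.commute)
    have "nab m P = (\<lambda>_. 0)"
    proof
      fix i
      have "nab m P i = of_nat (Suc i) *\<^sub>C P (Suc i) - N (P i)" by (simp add: nab_def N_def)
      also have "N (P i) = inverse (fact i) *\<^sub>C (N ^^ Suc i) w" by (simp add: P_def N_scale)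
      also have "of_nat (Suc i) *\<^sub>C P (Suc i) = (of_nat (Suc i) * inverse (fact (Suc i))) *\<^sub>C (N ^^ Suc i) w"
        by (simp add: P_def)
      also have "of_nat (Suc i) * inverse (fact (Suc i)) = (inverse (fact i) :: complex)"
        by (simp add: field_simps del: of_nat_Suc)
      finally show "nab m P i = 0" by simp
    qed
    moreover have "nab m (\<lambda>_. 0) = (\<lambda>_. 0)" by (simp add: nab_def)
    then have "(nab m ^^ j) (\<lambda>_. 0) = (\<lambda>_. 0)" for j by (induction j) simp_all
    ultimately have "(nab m ^^ j) P 0 \<in> X" for j
      using that(1) cv.subspace_0[OF X] by (cases j) (simp_all add: funpow_Suc_right P_def del: funpow.simps(2))
    then have "curve m X k P"
      using Ng k' by (auto simp: curve_def P_def intro!: geig_scale)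
    then have "P 0 \<in> E" by (rule *)
    then show ?thesis by (simp add: P_def)
  qed
  then have "cspan (\<Union>m. X \<inter> geig m) \<subseteq> E"
    using d_invD(1)[OF assms(2)] by (intro cv.span_minimal) auto
  then show ?thesis using assms(1) by (auto simp: graded_def)
qed

text \<open>The semisimple and the nilpotent limit in succession. After \<open>gr\<close> the space
  is spanned by homogeneous elements, the only ones that curves can reach, but it need not be
  d-stable; \<open>plim\<close> supplies the stability.\<close>

definition deform :: "'a set \<Rightarrow> 'a set" where
  "deform X = plim (gr X)"

lemma deform_inv: "d_inv (deform X)"
  by (simp add: deform_def plim_inv)

lemma deform_mono: "X \<subseteq> Y \<Longrightarrow> deform X \<subseteq> deform Y"
  unfolding deform_def by (intro plim_mono gr_mono)

lemma deform_of_inv: "d_inv X \<Longrightarrow> X \<subseteq> gspace \<Longrightarrow> deform X = X"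
  unfolding deform_def by (simp add: gr_inv plim_of_inv d_inv_graded)

lemma deform_br:
  assumes "x \<in> deform X" "y \<in> deform Y"
  shows "br x y \<in> deform (brset br X Y)"
proof -
  have "brset br (gr X) (gr Y) \<subseteq> gr (brset br X Y)"
    by (intro brset_least gr_subspace gr_br)
  then show ?thesis
    using plim_br assms plim_mono unfolding deform_def by blast
qed

text \<open>E is its own leading-term space and so lies in \<open>gr X\<close>. The second limit is
  therefore undone inside \<open>gr X\<close>, and then the first inside X.\<close>

lemma deform_reverse:
  assumes "cv.subspace X" "X \<subseteq> gspace" "d_inv E" "deform X \<subseteq> E" "E \<subseteq> X"
  shows "X \<subseteq> E"
proof -
  have "E \<subseteq> gr X"
    using gr_mono[OF assms(5)] unfolding gr_inv[OF assms(3) order_trans[OF assms(5,2)]] .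
  then have "gr X \<subseteq> E"
    by (rule plim_reverse[OF gr_graded assms(3) assms(4)[unfolded deform_def]])
  then show ?thesis
    by (rule gr_reverse[OF assms(1,2) d_invD(1)[OF assms(3)] _ assms(5)])
qed

text \<open>Brackets pass to the limit, so deforming does not lengthen the derived series.\<close>

lemma ds_deform: "derived_series br (deform X) n \<subseteq> deform (derived_series br X n)"
proof (induction n)
  case (Suc n)
  have "brset br (derived_series br (deform X) n) (derived_series br (deform X) n)
      \<subseteq> brset br (deform (derived_series br X n)) (deform (derived_series br X n))"
    by (intro brset_mono Suc)
  also have "\<dots> \<subseteq> deform (brset br (derived_series br X n) (derived_series br X n))"
    by (intro brset_least deform_br) (auto simp: d_invD deform_inv)
  finally show ?case by (simp add: derived_def)
qed simp

section \<open>Limits and exhaustion by finite-dimensional pieces\<close>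

lemma gr_chain:
  assumes G: "\<And>m. cv.subspace (G m)" "\<And>m::nat. G m \<subseteq> G (Suc m)" and X: "X \<subseteq> (\<Union>m. G m)"
    and "w \<in> gr X"
  shows "\<exists>m. w \<in> gr (X \<inter> G m)"
proof -
  have mono: "G i \<subseteq> G j" if "i \<le> j" for i j
    using lift_Suc_mono_le[of G, OF G(2) that] .
  have "w \<in> (\<Union>m. gr (X \<inter> G m))"
  proof -
    have "gr X \<subseteq> (\<Union>m. gr (X \<inter> G m))"
      unfolding gr_def[of X]
    proof (rule cv.span_minimal)
      show "cv.subspace (\<Union>m. gr (X \<inter> G m))"
        using G(2) by (intro subspace_Union_chain gr_subspace gr_mono) blast
      show "{w. \<exists>m. w \<in> geig m \<and> (\<exists>r\<in>low m. w + r \<in> X)} \<subseteq> (\<Union>m. gr (X \<inter> G m))"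
      proof clarify
        fix w m r assume w: "w \<in> geig m" "r \<in> low m" "w + r \<in> X"
        then obtain i where "w + r \<in> G i" using X by blast
        then have "w \<in> gr (X \<inter> G i)" unfolding gr_def using w by (intro cv.span_base) blast
        then show "w \<in> (\<Union>m. gr (X \<inter> G m))" by blast
      qed
    qed
    then show ?thesis using assms(4) by blast
  qed
  then show ?thesis by blast
qed

lemma d_inv_Union_chain:
  assumes "\<And>m. d_inv (G m)" "\<And>m::nat. G m \<subseteq> G (Suc m)"
  shows "d_inv (\<Union>m. G m)"
  using subspace_Union_chain[of G, OF d_invD(1)[OF assms(1)] assms(2)] d_invD(2)[OF assms(1)]
  by (auto simp: d_inv_def)

lemma plim_chain:
  assumes G: "\<And>m. d_inv (G m)" "\<And>m::nat. G m \<subseteq> G (Suc m)" and X: "X \<subseteq> (\<Union>m. G m)"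
    and "w \<in> plim X"
  shows "\<exists>m. w \<in> plim (X \<inter> G m)"
proof -
  have d_inv: "d_inv (\<Union>m. G m)" by (rule d_inv_Union_chain[of G, OF G])
  have "plim X \<subseteq> (\<Union>m. plim (X \<inter> G m))"
    unfolding plim_def[of X]
  proof (rule cv.span_minimal)
    show "cv.subspace (\<Union>m. plim (X \<inter> G m))"
      using G(2) by (intro subspace_Union_chain plim_subspace plim_mono) blast
    show "{w. \<exists>m k P. curve m X k P \<and> w = P k} \<subseteq> (\<Union>m. plim (X \<inter> G m))"
    proof clarify
      fix m k P assume P: "curve m X k P"
      then have "\<forall>i. P i \<in> (\<Union>m. G m)"
        using nab_pow_inv[OF d_inv, of m P] X by (auto simp: curve_def subset_iff)
      then have "P ` {..k} \<subseteq> (\<Union>m. G m)" by blast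
      then obtain n where n: "P ` {..k} \<subseteq> G n"
        using chain_finite_subset[of "P ` {..k}" G, OF _ _ G(2)] by blast
      have "\<forall>i. P i \<in> G n"
      proof
        fix i
        show "P i \<in> G n"
          using n P cv.subspace_0[OF d_invD(1)[OF G(1)]] by (cases "i \<le> k") (auto simp: curve_def not_le)
      qed
      then have "curve m (X \<inter> G n) k P"
        using P nab_pow_in[OF G(1)] by (auto simp: curve_def)
      then have "P k \<in> plim (X \<inter> G n)" by (rule plim_top)
      then show "P k \<in> (\<Union>m. plim (X \<inter> G m))" by blast
    qed
  qed
  then show ?thesis using assms(4) by blast
qed

text \<open>A locally solvable X need not have a derived length, so each element of the limit has to
  be traced to a piece X \<inter> \<open>G m\<close>. This works for each of the two limits because
  a combination or a curve involves finitely many vectors.\<close>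

lemma deform_chain:
  assumes G: "\<And>m. d_inv (G m)" "\<And>m::nat. G m \<subseteq> G (Suc m)" and fin: "\<And>m. \<exists>F. finite F \<and> G m \<subseteq> cspan F"
    and X: "X \<subseteq> (\<Union>m. G m)" "(\<Union>m. G m) \<subseteq> gspace" and w: "w \<in> deform X"
  shows "\<exists>m. w \<in> deform (X \<inter> G m)"
proof -
  have d_inv: "d_inv (\<Union>m. G m)" by (rule d_inv_Union_chain[of G, OF G])
  have "gr X \<subseteq> (\<Union>m. G m)" using gr_mono[OF X(1)] unfolding gr_inv[OF d_inv X(2)] .
  then have "\<exists>m. w \<in> plim (gr X \<inter> G m)"
    by (rule plim_chain[of G "gr X" w, OF G]) (use w in \<open>simp add: deform_def\<close>)
  then obtain m where m: "w \<in> plim (gr X \<inter> G m)" ..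
  obtain F where F: "finite F" "G m \<subseteq> cspan F" using fin by blast
  have "cv.subspace (gr X \<inter> G m)"
    by (intro cv.subspace_inter gr_subspace d_invD(1)[OF G(1)])
  \<comment> \<open>The second limit may use all of gr X \<inter> \<open>G m\<close>; a finite basis
    puts this whole space into the first limit of a single piece of X.\<close>
  then obtain B where B: "finite B" "B \<subseteq> gr X \<inter> G m" "cspan B = gr X \<inter> G m"
    by (rule subspace_finite_dim[OF _ le_infI2[OF F(2)] F(1)])
  have "gr X \<subseteq> (\<Union>n. gr (X \<inter> G n))"
  proof
    fix x assume "x \<in> gr X"
    from gr_chain[of G X, OF d_invD(1)[OF G(1)] G(2) X(1) this]
    show "x \<in> (\<Union>n. gr (X \<inter> G n))" by blast
  qed
  then have "B \<subseteq> (\<Union>n. gr (X \<inter> G n))" using B(2) by blast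
  moreover have "gr (X \<inter> G n) \<subseteq> gr (X \<inter> G (Suc n))" for n
    using G(2)[of n] by (intro gr_mono) blast
  ultimately obtain n where "B \<subseteq> gr (X \<inter> G n)"
    using chain_finite_subset[OF B(1)] by blast
  then have "gr X \<inter> G m \<subseteq> gr (X \<inter> G n)"
    unfolding B(3)[symmetric] by (intro cv.span_minimal gr_subspace)
  then have "w \<in> plim (gr (X \<inter> G n))" using m plim_mono[of "gr X \<inter> G m"] by blast
  then show ?thesis unfolding deform_def by blast
qed

end

section \<open>Locally reductive and finitary algebras\<close>

lemma reductive_in_complement:
  assumes "reductive_in br A B" "cv.subspace U" "U \<subseteq> B" "ad_stable br A U"
  obtains W where "cv.subspace W" "W \<subseteq> B" "ad_stable br A W" "\<And>x. x \<in> U \<Longrightarrow> x \<in> W \<Longrightarrow> x = 0"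
    "\<And>x. x \<in> B \<Longrightarrow> \<exists>u\<in>U. \<exists>w\<in>W. x = u + w"
proof -
  note ex = assms(1)[unfolded reductive_in_def, THEN conjunct2, THEN spec, THEN mp]
  have "csubspace U \<and> U \<subseteq> B \<and> ad_stable br A U"
    using assms(2-4) by (simp add: csubspace_iff)
  from ex[OF this] obtain W where W: "csubspace W" "W \<subseteq> B" "ad_stable br A W" "U \<inter> W = {0}"
    "{u + w | u w. u \<in> U \<and> w \<in> W} = B"
    by (elim exE conjE)
  have 1: "x = 0" if "x \<in> U" "x \<in> W" for x
  proof -
    have "x \<in> U \<inter> W" using that by simp
    then show ?thesis unfolding W(4) by simp
  qed
  have 2: "\<exists>u\<in>U. \<exists>w\<in>W. x = u + w" if "x \<in> B" for x
  proof -
    have "x \<in> {u + w | u w. u \<in> U \<and> w \<in> W}" using that by (simp only: W(5))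
    then show ?thesis by blast
  qed
  show thesis by (rule that[OF W(1)[unfolded csubspace_iff] W(2,3) 1 2])
qed

section \<open>Ideals and centers in a chain of reductive algebras\<close>

locale reductive_chain = lie br for br :: "'a::complex_vector \<Rightarrow> 'a \<Rightarrow> 'a" +
  fixes G :: "nat \<Rightarrow> 'a set"
  assumes G_sub: "cv.subspace (G m)"
    and G_br: "x \<in> G m \<Longrightarrow> y \<in> G m \<Longrightarrow> br x y \<in> G m"
    and G_fin: "\<exists>F. finite F \<and> cspan F = G m"
    and G_Suc: "G m \<subseteq> G (Suc m)"
    and G_red: "reductive_in br (G m) (G m)"
    and G_red_Suc: "reductive_in br (G m) (G (Suc m))"
begin

definition alg :: "'a set" where
  "alg = (\<Union>m. G m)"

lemma G_mono: "i \<le> j \<Longrightarrow> G i \<subseteq> G j"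
  using lift_Suc_mono_le[of G, OF G_Suc] .

lemma alg_sub: "cv.subspace alg"
  unfolding alg_def by (rule subspace_Union_chain[of G, OF G_sub G_Suc])

lemma alg_finite:
  assumes "finite F" "F \<subseteq> alg"
  obtains m where "m \<ge> k" "F \<subseteq> G m"
  using chain_finite_subset[OF assms[unfolded alg_def] G_Suc] by metis

lemma alg_pair:
  assumes "x \<in> alg" "y \<in> alg"
  obtains m where "x \<in> G m" "y \<in> G m"
proof -
  obtain i j where "x \<in> G i" "y \<in> G j" using assms by (auto simp: alg_def)
  then have "x \<in> G (max i j)" "y \<in> G (max i j)"
    using G_mono[of i "max i j"] G_mono[of j "max i j"] by auto
  then show thesis by (rule that)
qed

lemma alg_br: "x \<in> alg \<Longrightarrow> y \<in> alg \<Longrightarrow> br x y \<in> alg"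
  by (erule (1) alg_pair) (simp add: alg_def, blast intro: G_br)

definition ideal :: "nat \<Rightarrow> 'a set \<Rightarrow> bool" where
  "ideal m U \<longleftrightarrow> cv.subspace U \<and> U \<subseteq> G m \<and> (\<forall>a\<in>G m. \<forall>u\<in>U. br a u \<in> U)"

lemma idealD:
  assumes "ideal m U"
  shows "cv.subspace U" "U \<subseteq> G m" "a \<in> G m \<Longrightarrow> u \<in> U \<Longrightarrow> br a u \<in> U" "a \<in> G m \<Longrightarrow> u \<in> U \<Longrightarrow> br u a \<in> U"
proof -
  show 1: "cv.subspace U" "U \<subseteq> G m" "a \<in> G m \<Longrightarrow> u \<in> U \<Longrightarrow> br a u \<in> U" for a u
    using assms by (auto simp: ideal_def)
  show "a \<in> G m \<Longrightarrow> u \<in> U \<Longrightarrow> br u a \<in> U"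
    using 1(3)[of a u] antisym[of u a] cv.subspace_neg[OF 1(1)] by simp
qed

text \<open>The complement W given by reductivity is an ideal too, so brackets between U and W lie
  in both and vanish.\<close>

lemma ideal_complement:
  assumes "ideal m U"
  obtains W where "ideal m W" "\<And>u w. u \<in> U \<Longrightarrow> w \<in> W \<Longrightarrow> br u w = 0" "\<And>x. x \<in> U \<Longrightarrow> x \<in> W \<Longrightarrow> x = 0"
    "\<And>x. x \<in> G m \<Longrightarrow> \<exists>u\<in>U. \<exists>w\<in>W. x = u + w"
proof -
  have "ad_stable br (G m) U" using idealD(3)[OF assms] by (simp add: ad_stable_def)
  then obtain W where W: "cv.subspace W" "W \<subseteq> G m" "ad_stable br (G m) W"
    "\<And>x. x \<in> U \<Longrightarrow> x \<in> W \<Longrightarrow> x = 0" "\<And>x. x \<in> G m \<Longrightarrow> \<exists>u\<in>U. \<exists>w\<in>W. x = u + w"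
    using reductive_in_complement[OF G_red idealD(1,2)[OF assms]] by metis
  then have id: "ideal m W" by (simp add: ideal_def ad_stable_def)
  have "br u w = 0" if "u \<in> U" "w \<in> W" for u w
  proof (rule W(4))
    show "br u w \<in> W" using idealD(3)[OF id, of u w] idealD(2)[OF assms] that by blast
    show "br u w \<in> U" using idealD(4)[OF assms, of w u] W(2) that by blast
  qed
  then show thesis by (rule that[OF id _ W(4,5)])
qed

lemma derived_sub: "cv.subspace (derived br X)"
  by (simp add: derived_def brset_subspace)

lemma derived_ideal:
  assumes "ideal m Q"
  shows "ideal m (derived br Q)" "derived br Q \<subseteq> Q"
proof -
  show sub: "derived br Q \<subseteq> Q"
    unfolding derived_def
  proof (rule brset_least[OF idealD(1)[OF assms]])
    show "br x y \<in> Q" if "x \<in> Q" "y \<in> Q" for x y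
      using idealD(3)[OF assms, of x y] idealD(2)[OF assms] that by blast
  qed
  have "br a u \<in> derived br Q" if "a \<in> G m" "u \<in> derived br Q" for a u
    unfolding derived_def
  proof (rule br_span_span[of _ "{a}"])
    show "a \<in> cspan {a}" by (simp add: cv.span_base)
    show "u \<in> cspan {br x y | x y. x \<in> Q \<and> y \<in> Q}" using that(2) by (simp add: derived_def brset_def)
    fix a' z assume "a' \<in> {a}" "z \<in> {br x y | x y. x \<in> Q \<and> y \<in> Q}"
    then obtain x y where z: "a' = a" "z = br x y" "x \<in> Q" "y \<in> Q" by blast
    have "br a x \<in> Q" "br a y \<in> Q" using idealD(3)[OF assms that(1)] z by auto
    then have "br (br a x) y + br x (br a y) \<in> brset br Q Q"
      using z by (intro cv.subspace_add[OF brset_subspace] brset_in)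
    then show "br a' z \<in> brset br Q Q" unfolding z leibniz[of a x y] .
  qed (rule brset_subspace)
  then show "ideal m (derived br Q)"
    using order_trans[OF sub idealD(2)[OF assms]] derived_sub by (simp add: ideal_def)
qed

definition center :: "nat \<Rightarrow> 'a set" where
  "center m = {c \<in> G m. \<forall>x\<in>G m. br c x = 0}"

lemma center_br: "c \<in> center m \<Longrightarrow> x \<in> G m \<Longrightarrow> br x c = 0"
  using antisym[of x c] by (auto simp: center_def)

lemma ideal_G: "ideal m (G m)"
  by (simp add: ideal_def G_sub G_br)

lemma center_ideal: "ideal m (center m)"
  unfolding ideal_def
proof (intro conjI ballI)
  show "cv.subspace (center m)"
    by (intro cv.subspaceI) (auto simp: center_def add_left scale_left cv.subspace_0 cv.subspace_add cv.subspace_scale G_sub)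
  show "br a u \<in> center m" if "a \<in> G m" "u \<in> center m" for a u
    using center_br[OF that(2,1)] cv.subspace_0[OF G_sub] by (simp add: center_def)
qed (auto simp: center_def)

text \<open>\<open>G m\<close> is its center plus an ideal W, and brackets do not see the center; so
  the derived algebra lies in W.\<close>

lemma center_derived:
  assumes "c \<in> center m" "c \<in> derived br (G m)"
  shows "c = 0"
proof -
  obtain W where W: "ideal m W" "\<And>x. x \<in> center m \<Longrightarrow> x \<in> W \<Longrightarrow> x = 0"
    "\<And>x. x \<in> G m \<Longrightarrow> \<exists>u\<in>center m. \<exists>w\<in>W. x = u + w"
    using ideal_complement[OF center_ideal, of m] by metis
  have "derived br (G m) \<subseteq> W"
    unfolding derived_def
  proof (rule brset_least[OF idealD(1)[OF W(1)]])
    fix x y assume xy: "x \<in> G m" "y \<in> G m"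
    obtain u w where u: "u \<in> center m" "w \<in> W" "x = u + w" using W(3)[OF xy(1)] by blast
    then have "br x y = br w y" using xy by (simp add: add_left center_def)
    then show "br x y \<in> W" using idealD(4)[OF W(1) xy(2) u(2)] by simp
  qed
  then show ?thesis using W(2) assms by blast
qed

lemma abelian_ideal_central:
  assumes "ideal m A" "\<And>x y. x \<in> A \<Longrightarrow> y \<in> A \<Longrightarrow> br x y = 0"
  shows "A \<subseteq> center m"
proof
  fix a assume a: "a \<in> A"
  obtain W where W: "\<And>u w. u \<in> A \<Longrightarrow> w \<in> W \<Longrightarrow> br u w = 0"
    "\<And>x. x \<in> G m \<Longrightarrow> \<exists>u\<in>A. \<exists>w\<in>W. x = u + w"
    using ideal_complement[OF assms(1)] by metis
  have "br a x = 0" if "x \<in> G m" for x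
    using W(2)[OF that] W(1)[OF a] assms(2)[OF a] by (auto simp: add_right)
  then show "a \<in> center m" using a idealD(2)[OF assms(1)] by (auto simp: center_def)
qed

text \<open>Let W be a complement of [Q, Q] and c the W-component of q. Then [c, Q] lies in W
  \<inter> [Q, Q] = 0, and c, being in Q, commutes with a complement of Q.\<close>

lemma ideal_derived_center:
  assumes "ideal m Q" "q \<in> Q"
  obtains a c where "a \<in> derived br Q" "c \<in> center m" "c \<in> Q" "q = a + c"
proof -
  note D = derived_ideal[OF assms(1)]
  obtain W where W: "ideal m W" "\<And>x. x \<in> derived br Q \<Longrightarrow> x \<in> W \<Longrightarrow> x = 0"
    "\<And>x. x \<in> G m \<Longrightarrow> \<exists>u\<in>derived br Q. \<exists>w\<in>W. x = u + w"
    using ideal_complement[OF D(1)] by metis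
  obtain V where V: "\<And>u w. u \<in> Q \<Longrightarrow> w \<in> V \<Longrightarrow> br u w = 0"
    "\<And>x. x \<in> G m \<Longrightarrow> \<exists>u\<in>Q. \<exists>w\<in>V. x = u + w"
    using ideal_complement[OF assms(1)] by metis
  obtain a c where ac: "a \<in> derived br Q" "c \<in> W" "q = a + c"
    using W(3) assms idealD(2)[OF assms(1)] by blast
  have "c = q - a" using ac by simp
  then have cQ: "c \<in> Q" using assms(2) ac(1) D(2) cv.subspace_diff[OF idealD(1)[OF assms(1)]] by blast
  have "br c x = 0" if xG: "x \<in> G m" for x
  proof -
    obtain u v where uv: "u \<in> Q" "v \<in> V" "x = u + v" using V(2)[OF xG] by blast
    have "u \<in> G m" using uv(1) idealD(2)[OF assms(1)] by blast
    then have "br c u \<in> W" using idealD(4)[OF W(1)] ac(2) by blast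
    moreover have "br c u \<in> derived br Q" unfolding derived_def using brset_in[OF cQ uv(1)] .
    ultimately have "br c u = 0" using W(2) by blast
    then show ?thesis using V(1)[OF cQ uv(2)] by (simp add: uv(3) add_right)
  qed
  then have "c \<in> center m" using cQ idealD(2)[OF assms(1)] by (auto simp: center_def)
  then show thesis using that ac cQ by blast
qed

text \<open>The kernel K of ad c is stable under \<open>G m\<close> because c is central there, so
  it has a \<open>G m\<close>-stable complement W. On W, ad c is injective, which rules out
  nilpotent Jordan blocks.\<close>

lemma center_semisimple:
  assumes c: "c \<in> center m" and x: "x \<in> G (Suc m)" "br c (br c x) = 0"
  shows "br c x = 0"
proof -
  define K where "K = {x \<in> G (Suc m). br c x = 0}"
  have cG: "c \<in> G m" using c by (simp add: center_def)
  have sub: "cv.subspace K" unfolding K_def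
    by (intro cv.subspaceI) (auto simp: add_right scale_right cv.subspace_0 cv.subspace_add cv.subspace_scale G_sub)
  have "br a u \<in> K" if "a \<in> G m" "u \<in> K" for a u
  proof -
    have "br c (br a u) = 0"
      using that c by (simp add: K_def leibniz[of c a u] center_def)
    then show ?thesis using that G_Suc[of m] G_br[of a "Suc m" u] by (auto simp: K_def)
  qed
  then have ad: "ad_stable br (G m) K" by (simp add: ad_stable_def)
  have "K \<subseteq> G (Suc m)" by (auto simp: K_def)
  then obtain W where "cv.subspace W" and W: "W \<subseteq> G (Suc m)" "ad_stable br (G m) W" "\<And>x. x \<in> K \<Longrightarrow> x \<in> W \<Longrightarrow> x = 0"
    "\<And>x. x \<in> G (Suc m) \<Longrightarrow> \<exists>u\<in>K. \<exists>w\<in>W. x = u + w"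
    using reductive_in_complement[OF G_red_Suc sub _ ad] by metis
  obtain u w where uw: "u \<in> K" "w \<in> W" "x = u + w"
    using W(4)[OF x(1)] by blast
  have cw: "br c w \<in> W" "br c x = br c w"
    using W(2) cG uw by (auto simp: ad_stable_def K_def add_right)
  then have "br c w \<in> K" using W(1) x(2) by (auto simp: K_def)
  then show ?thesis using W(3)[of "br c w"] cw by simp
qed

end

section \<open>A finitary representation: ideals and their centralizers\<close>

locale finitary_chain = reductive_chain br G
  for br :: "'a::complex_vector \<Rightarrow> 'a \<Rightarrow> 'a" and G :: "nat \<Rightarrow> 'a set" +
  fixes \<rho> :: "'a \<Rightarrow> 'v::complex_vector \<Rightarrow> 'v"
  assumes rho_add: "\<rho> (x + y) v = \<rho> x v + \<rho> y v"
    and rho_scale: "\<rho> (c *\<^sub>C x) v = c *\<^sub>C \<rho> x v"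
    and rho_addv: "\<rho> x (u + v) = \<rho> x u + \<rho> x v"
    and rho_scalev: "\<rho> x (c *\<^sub>C v) = c *\<^sub>C \<rho> x v"
    and rho_br: "\<rho> (br x y) v = \<rho> x (\<rho> y v) - \<rho> y (\<rho> x v)"
    and faithful: "x \<in> alg \<Longrightarrow> (\<And>v. \<rho> x v = 0) \<Longrightarrow> x = 0"
    and finite_rank: "x \<in> alg \<Longrightarrow> \<exists>F. finite F \<and> range (\<rho> x) \<subseteq> cspan F"
begin

lemma rho_0 [simp]: "\<rho> 0 v = 0"
  using rho_scale[of 0 0 v] by simp

lemma rho_0v [simp]: "\<rho> x 0 = 0"
  using rho_scalev[of x 0 0] by simp

lemma rho_diff: "\<rho> (x - y) v = \<rho> x v - \<rho> y v"
  using rho_add[of x "(-1) *\<^sub>C y" v] rho_scale[of "-1" y v] by simp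

lemma rho_diffv: "\<rho> x (u - v) = \<rho> x u - \<rho> x v"
  using rho_addv[of x u "(-1) *\<^sub>C v"] rho_scalev[of x "-1" v] by simp

lemma rho_minusv: "\<rho> x (- v) = - \<rho> x v"
  using rho_diffv[of x 0 v] by simp

definition act :: "'a set \<Rightarrow> 'v set" where
  "act A = cspan {\<rho> x v | x v. x \<in> A}"

lemma act_sub: "cv.subspace (act A)"
  by (simp add: act_def)

lemma act_in: "x \<in> A \<Longrightarrow> \<rho> x v \<in> act A"
  unfolding act_def by (rule cv.span_base) blast

lemma act_mono: "A \<subseteq> B \<Longrightarrow> act A \<subseteq> act B"
  unfolding act_def by (rule cv.span_mono) blast

lemma act_maps:
  assumes "cv.subspace Z" "\<And>x v. x \<in> A \<Longrightarrow> \<rho> u (\<rho> x v) \<in> Z" "w \<in> act A"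
  shows "\<rho> u w \<in> Z"
  using assms(3) unfolding act_def
proof (induction rule: cv.span_induct_alt)
  case base
  then show ?case using cv.subspace_0[OF assms(1)] by simp
next
  case (step c x y)
  then have "\<rho> u x \<in> Z" using assms(2) by blast
  then show ?case using step.IH
    by (simp add: rho_addv rho_scalev cv.subspace_add[OF assms(1)] cv.subspace_scale[OF assms(1)])
qed

lemma act_kills:
  assumes "\<And>x v. x \<in> A \<Longrightarrow> \<rho> u (\<rho> x v) = 0" "w \<in> act A"
  shows "\<rho> u w = 0"
  using act_maps[of "{0}" A u w] assms by simp

definition H :: "'a set" where
  "H = derived br (G 0)"

text \<open>The ideal of \<open>G m\<close> generated by H. These ideals increase, and their union I
  is the ideal of \<open>alg\<close> generated by H.\<close>

definition J :: "nat \<Rightarrow> 'a set" where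
  "J m = \<Inter>{X. cv.subspace X \<and> H \<subseteq> X \<and> (\<forall>a\<in>G m. \<forall>x\<in>X. br a x \<in> X)}"

lemma J_least: "cv.subspace X \<Longrightarrow> H \<subseteq> X \<Longrightarrow> (\<And>a x. a \<in> G m \<Longrightarrow> x \<in> X \<Longrightarrow> br a x \<in> X) \<Longrightarrow> J m \<subseteq> X"
  unfolding J_def by blast

lemma H_J: "H \<subseteq> J m"
  unfolding J_def by blast

lemma J_sub: "cv.subspace (J m)"
  unfolding J_def by (intro cv.subspace_Inter) blast

lemma J_stable: "a \<in> G m \<Longrightarrow> x \<in> J m \<Longrightarrow> br a x \<in> J m"
  unfolding J_def by blast

lemma J_derived: "J m \<subseteq> derived br (G m)"
proof (rule J_least[OF derived_sub])
  show "H \<subseteq> derived br (G m)"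
    unfolding H_def derived_def by (intro brset_mono G_mono) auto
qed (use idealD(3)[OF derived_ideal(1)[OF ideal_G]] in blast)

lemma J_ideal: "ideal m (J m)"
  using J_sub J_stable order_trans[OF J_derived derived_ideal(2)[OF ideal_G]] by (simp add: ideal_def)

lemma J_Suc: "J m \<subseteq> J (Suc m)"
  using G_Suc J_stable by (intro J_least J_sub H_J) blast

lemma J_mono: "i \<le> j \<Longrightarrow> J i \<subseteq> J j"
  using lift_Suc_mono_le[of J, OF J_Suc] .

definition I :: "'a set" where
  "I = (\<Union>m. J m)"

lemma I_sub: "cv.subspace I"
  unfolding I_def by (rule subspace_Union_chain[of J, OF J_sub J_Suc])

lemma J_I: "J m \<subseteq> I"
  by (auto simp: I_def)

lemma I_alg: "I \<subseteq> alg"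
  using idealD(2)[OF J_ideal] by (fastforce simp: I_def alg_def)

lemma I_stable:
  assumes "a \<in> alg" "x \<in> I"
  shows "br a x \<in> I"
proof -
  obtain i j where "a \<in> G i" "x \<in> J j" using assms by (auto simp: alg_def I_def)
  then have "a \<in> G (max i j)" "x \<in> J (max i j)"
    using G_mono[of i "max i j"] J_mono[of j "max i j"] by auto
  then show ?thesis using J_stable J_I by blast
qed

lemma act_I_stable:
  assumes "a \<in> alg" "v \<in> act I"
  shows "\<rho> a v \<in> act I"
  using assms(2)
proof (rule act_maps[OF act_sub, rotated])
  fix x v assume x: "x \<in> I"
  have "\<rho> a (\<rho> x v) = \<rho> (br a x) v + \<rho> x (\<rho> a v)" by (simp add: rho_br)
  then show "\<rho> a (\<rho> x v) \<in> act I"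
    using act_in[OF x] act_in[OF I_stable[OF assms(1) x]] act_sub by (simp add: cv.subspace_add)
qed

lemma act_J_stable:
  assumes "a \<in> G m" "v \<in> act (J m)"
  shows "\<rho> a v \<in> act (J m)"
  using assms(2)
proof (rule act_maps[OF act_sub, rotated])
  fix x v assume x: "x \<in> J m"
  have "\<rho> a (\<rho> x v) = \<rho> (br a x) v + \<rho> x (\<rho> a v)" by (simp add: rho_br)
  then show "\<rho> a (\<rho> x v) \<in> act (J m)"
    using act_in[OF x] act_in[OF J_stable[OF assms(1) x]] act_sub by (simp add: cv.subspace_add)
qed

lemma act_I_Union: "act I = (\<Union>m. act (J m))"
proof
  show "act I \<subseteq> (\<Union>m. act (J m))"
    unfolding act_def[of I]
  proof (rule cv.span_minimal)
    show "cv.subspace (\<Union>m. act (J m))"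
      by (intro subspace_Union_chain act_sub act_mono J_Suc)
  qed (use act_in in \<open>auto simp: I_def\<close>)
qed (use act_mono[OF J_I] in blast)

definition Z :: "'a set" where
  "Z = {z \<in> alg. \<forall>x\<in>I. br z x = 0}"

lemma Z_sub: "cv.subspace Z"
  unfolding Z_def
  by (intro cv.subspaceI) (auto simp: add_left scale_left cv.subspace_0 cv.subspace_add cv.subspace_scale alg_sub)

lemma Z_stable:
  assumes "a \<in> alg" "z \<in> Z"
  shows "br a z \<in> Z"
proof -
  have "br (br a z) x = 0" if "x \<in> I" for x
    using leibniz[of a z x] I_stable[OF assms(1) that] that assms(2) by (simp add: Z_def)
  then show ?thesis using assms alg_br by (simp add: Z_def)
qed

definition ann :: "'a set" where
  "ann = {a \<in> alg. \<forall>v\<in>act I. \<rho> a v = 0}"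

lemma ann_sub: "cv.subspace ann"
  unfolding ann_def
  by (intro cv.subspaceI) (auto simp: rho_add rho_scale cv.subspace_0 cv.subspace_add cv.subspace_scale alg_sub)

lemma ann_stable:
  assumes "a \<in> alg" "x \<in> ann"
  shows "br a x \<in> ann"
  using assms alg_br act_I_stable[OF assms(1)] by (simp add: ann_def rho_br)

text \<open>For y, z in A = ann \<inter> I \<inter> \<open>G m\<close>, the operators y z and z y
  are 0, because y and z map into \<open>act I\<close> and kill it; so [y, z] = 0 by faithfulness.
  The abelian ideal A is central, whereas x lies in the derived algebra of
  \<open>G m\<close>.\<close>

lemma ann_Int_I: "x \<in> ann \<Longrightarrow> x \<in> I \<Longrightarrow> x = 0"
proof -
  assume x: "x \<in> ann" "x \<in> I"
  obtain m where m: "x \<in> J m" using x(2) by (auto simp: I_def)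
  let ?A = "ann \<inter> I \<inter> G m"
  have "ideal m ?A"
    unfolding ideal_def
  proof (intro conjI ballI)
    show "cv.subspace ?A" by (intro cv.subspace_inter ann_sub I_sub G_sub)
    fix a u assume "a \<in> G m" "u \<in> ?A"
    moreover then have "a \<in> alg" by (auto simp: alg_def)
    ultimately show "br a u \<in> ?A" using ann_stable I_stable G_br by blast
  qed auto
  moreover have "br y z = 0" if "y \<in> ?A" "z \<in> ?A" for y z
  proof (rule faithful)
    show "br y z \<in> alg" using that by (intro alg_br) (auto simp: ann_def)
    show "\<rho> (br y z) v = 0" for v
      using that act_in[of z I v] act_in[of y I v] by (simp add: rho_br ann_def)
  qed
  ultimately have "?A \<subseteq> center m" by (rule abelian_ideal_central)
  moreover have "x \<in> G m" using m idealD(2)[OF J_ideal] by blast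
  ultimately have "x \<in> center m" using x by blast
  then show "x = 0" using center_derived m J_derived by blast
qed

text \<open>Both \<open>ann\<close> and I are ideals, so [a, x] lies in their zero
  intersection.\<close>

lemma ann_Z: "ann \<subseteq> Z"
proof
  fix a assume a: "a \<in> ann"
  then have alg: "a \<in> alg" by (simp add: ann_def)
  have "br a x = 0" if x: "x \<in> I" for x
  proof (rule ann_Int_I)
    show "br a x \<in> I" using I_stable alg x by blast
    have "br x a \<in> ann" using ann_stable a x I_alg by blast
    then show "br a x \<in> ann" using antisym[of a x] cv.subspace_neg[OF ann_sub] by simp
  qed
  then show "a \<in> Z" using alg by (simp add: Z_def)
qed

text \<open>An element of \<open>Q m\<close> is the sum of an element of $[Q_m, Q_m]$, which kills \<open>act I\<close>, and an element
  $c$ of the center of \<open>G m\<close>. As $c^2$ kills \<open>act I\<close>, \<open>ad c\<close> is nilpotent on \<open>I\<close>; it is also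
  semisimple on \<open>G (Suc m)\<close>. Hence \<open>Q m\<close> commutes with \<open>I \<inter> G (Suc m)\<close>, which puts it into
  \<open>Q (Suc m)\<close>, and inductively it commutes with all of \<open>I\<close>.\<close>

definition Q :: "nat \<Rightarrow> 'a set" where
  "Q m = {u \<in> G m. (\<forall>j\<in>J m. br u j = 0) \<and> (\<forall>v\<in>act (J m). \<rho> u v = 0) \<and> (\<forall>v\<in>act I. \<rho> u v \<in> act (J m))}"

text \<open>As u commutes with \<open>J m\<close>, the x in \<open>J m\<close> with u x = 0 as
  operators are closed under brackets with \<open>J m\<close>, hence with \<open>G m\<close>, which
  is \<open>J m\<close> plus an ideal commuting with it. They include H and so exhaust
  \<open>J m\<close>.\<close>

lemma kills_act_J:
  assumes u: "u \<in> G m" "\<forall>j\<in>J m. br u j = 0" "\<forall>e\<in>act H. \<rho> u e = 0" and v: "v \<in> act (J m)"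
  shows "\<rho> u v = 0"
proof -
  let ?X = "{x \<in> J m. \<forall>v. \<rho> u (\<rho> x v) = 0}"
  obtain W where W: "\<And>x w. x \<in> J m \<Longrightarrow> w \<in> W \<Longrightarrow> br x w = 0"
    "\<And>x. x \<in> G m \<Longrightarrow> \<exists>y\<in>J m. \<exists>w\<in>W. x = y + w"
    using ideal_complement[OF J_ideal[of m]] by metis
  have comm: "\<rho> u (\<rho> j v) = \<rho> j (\<rho> u v)" if "j \<in> J m" for j v
    using rho_br[of u j v] u(2) that by simp
  have "J m \<subseteq> ?X"
  proof (rule J_least)
    show "cv.subspace ?X"
      by (intro cv.subspaceI)
        (auto simp: rho_add rho_scale rho_addv rho_scalev cv.subspace_0 cv.subspace_add cv.subspace_scale J_sub)
    show "H \<subseteq> ?X" using H_J u(3) act_in by blast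
    fix a x assume a: "a \<in> G m" and x: "x \<in> ?X"
    obtain y w where y: "y \<in> J m" "w \<in> W" "a = y + w" using W(2)[OF a] by blast
    have "br w x = 0" using W(1)[of x w] x y antisym[of w x] by simp
    then have ax: "br a x = br y x" by (simp add: y add_left)
    have "\<rho> u (\<rho> (br y x) v) = 0" for v
      using x comm[OF y(1)] by (simp add: rho_br rho_diffv)
    then show "br a x \<in> ?X" using ax J_stable[OF a, of x] x by simp
  qed
  then show ?thesis using act_kills[of "J m" u v] v by blast
qed

lemma Q_ideal: "ideal m (Q m)"
  unfolding ideal_def
proof (intro conjI ballI)
  show "cv.subspace (Q m)"
    unfolding Q_def
    by (intro cv.subspaceI)
      (auto simp: add_left scale_left rho_add rho_scale cv.subspace_0 cv.subspace_add cv.subspace_scale G_sub act_sub)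
  fix a u assume a: "a \<in> G m" and u: "u \<in> Q m"
  have alg: "a \<in> alg" using a by (auto simp: alg_def)
  show "br a u \<in> Q m"
    unfolding Q_def
  proof (intro CollectI conjI ballI)
    show "br a u \<in> G m" using a u by (simp add: Q_def G_br)
    show "br (br a u) j = 0" if "j \<in> J m" for j
      using leibniz[of a u j] J_stable[OF a that] that u by (simp add: Q_def)
    show "\<rho> (br a u) v = 0" if "v \<in> act (J m)" for v
      using act_J_stable[OF a that] that u by (simp add: Q_def rho_br)
    show "\<rho> (br a u) v \<in> act (J m)" if v: "v \<in> act I" for v
      using act_I_stable[OF alg v] act_J_stable[OF a] v u cv.subspace_diff[OF act_sub]
      by (simp add: Q_def rho_br)
  qed
qed (auto simp: Q_def)

lemma Q_square: "u \<in> Q m \<Longrightarrow> u' \<in> Q m \<Longrightarrow> v \<in> act I \<Longrightarrow> \<rho> u (\<rho> u' v) = 0"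
  by (simp add: Q_def)

lemma Q_commutes:
  assumes u: "u \<in> Q m" and x: "x \<in> I" "x \<in> G (Suc m)"
  shows "br u x = 0"
proof -
  obtain a c where ac: "a \<in> derived br (Q m)" "c \<in> center m" "c \<in> Q m" "u = a + c"
    using ideal_derived_center[OF Q_ideal u] .
  have "derived br (Q m) \<subseteq> ann"
    unfolding derived_def
  proof (rule brset_least[OF ann_sub])
    fix y z assume yz: "y \<in> Q m" "z \<in> Q m"
    then have "br y z \<in> G m" by (intro G_br) (auto simp: Q_def)
    then show "br y z \<in> ann" using yz Q_square by (auto simp: ann_def alg_def rho_br)
  qed
  then have "br a x = 0" using ac(1) ann_Z x(1) by (auto simp: Z_def)
  moreover have "br c x = 0"
  proof -
    have calg: "c \<in> alg" using ac(3) by (auto simp: Q_def alg_def)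
    \<comment> \<open>Three brackets are taken because ad(c)^3 x is a combination of c^3 x, c^2 x c,
      c x c^2 and x c^3, all zero on \<open>act I\<close>; in ad(c)^2 x the term c x c could
      survive.\<close>
    let ?x1 = "br c x" let ?x2 = "br c ?x1" let ?x3 = "br c ?x2"
    have I: "?x3 \<in> I" using I_stable calg x(1) by blast
    have "\<rho> ?x3 v = 0" if v: "v \<in> act I" for v
    proof -
      note sq = Q_square[OF ac(3) ac(3)]
      have inI: "\<rho> x w \<in> act I" for w using act_in[OF x(1)] .
      have cI: "\<rho> c v \<in> act I" using act_I_stable[OF calg v] .
      show ?thesis
        using sq[OF v] sq[OF inI] sq[OF cI] by (simp add: rho_br rho_diffv rho_minusv)
    qed
    then have "?x3 \<in> ann" using I I_alg by (auto simp: ann_def)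
    then have "?x3 = 0" using ann_Int_I I by blast
    moreover have "?x1 \<in> G (Suc m)"
      using ac(3) x(2) G_Suc[of m] by (intro G_br) (auto simp: Q_def)
    ultimately have "?x2 = 0" using center_semisimple[OF ac(2)] by blast
    then show ?thesis using center_semisimple[OF ac(2) x(2)] by blast
  qed
  ultimately show ?thesis by (simp add: ac(4) add_left)
qed

text \<open>The new kernel condition holds because u kills \<open>act H\<close> and, by
  \<open>Q_commutes\<close>, also commutes with the larger ideal \<open>J (Suc m)\<close>.\<close>

lemma Q_Suc: "Q m \<subseteq> Q (Suc m)"
proof
  fix u assume u: "u \<in> Q m"
  have G: "u \<in> G (Suc m)" using u G_Suc by (auto simp: Q_def)
  have comm: "\<forall>j\<in>J (Suc m). br u j = 0"
    using Q_commutes[OF u] J_I idealD(2)[OF J_ideal] by blast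
  have "\<forall>e\<in>act H. \<rho> u e = 0" using u act_mono[OF H_J] by (auto simp: Q_def)
  then have "\<forall>v\<in>act (J (Suc m)). \<rho> u v = 0" using kills_act_J[OF G comm] by blast
  moreover have "\<forall>v\<in>act I. \<rho> u v \<in> act (J (Suc m))"
    using u act_mono[OF J_Suc[of m]] by (auto simp: Q_def)
  ultimately show "u \<in> Q (Suc m)" using G comm by (simp add: Q_def)
qed

lemma Q_Z: "Q m \<subseteq> Z"
proof
  fix u assume u: "u \<in> Q m"
  have "br u x = 0" if x: "x \<in> I" for x
  proof -
    obtain k where "x \<in> G k" using x I_alg by (auto simp: alg_def)
    then have "x \<in> G (Suc (max m k))"
      using G_mono[OF le_SucI[OF max.cobounded2[of k m]]] by blast
    moreover have "u \<in> Q (max m k)"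
      using u lift_Suc_mono_le[of Q, OF Q_Suc, of m "max m k"] by auto
    ultimately show ?thesis using Q_commutes x by blast
  qed
  then show "u \<in> Z" using u by (auto simp: Z_def Q_def alg_def)
qed

lemma act_H_finite:
  obtains F where "finite F" "F \<subseteq> act H" "act H = cspan F"
proof -
  obtain F0 where F0: "finite F0" "cspan F0 = G 0" using G_fin by blast
  have "H \<subseteq> cspan F0" unfolding H_def F0(2) by (rule derived_ideal(2)[OF ideal_G])
  then obtain B where B: "finite B" "B \<subseteq> H" "cspan B = H"
    using subspace_finite_dim[of H F0] derived_sub F0(1) unfolding H_def by metis
  have "H \<subseteq> alg" using \<open>H \<subseteq> cspan F0\<close> F0 by (auto simp: alg_def)
  then have "\<forall>x\<in>B. \<exists>F. finite F \<and> range (\<rho> x) \<subseteq> cspan F" using B(2) finite_rank by blast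
  then obtain f where f: "\<forall>x\<in>B. finite (f x) \<and> range (\<rho> x) \<subseteq> cspan (f x)" by metis
  let ?F = "\<Union>x\<in>B. f x"
  have "act H \<subseteq> cspan ?F"
    unfolding act_def
  proof (rule cv.span_minimal)
    have "\<rho> h v \<in> cspan ?F" if "h \<in> cspan B" for h v
      using that
    proof (induction rule: cv.span_induct_alt)
      case (step c x y)
      have "cspan (f x) \<subseteq> cspan ?F" by (rule cv.span_mono) (use step.hyps in blast)
      then have "\<rho> x v \<in> cspan ?F" using f step.hyps by blast
      then show ?case using step.IH by (simp add: rho_add rho_scale cv.span_add cv.span_scale)
    qed (simp add: cv.span_zero)
    then show "{\<rho> x v | x v. x \<in> H} \<subseteq> cspan ?F" using B(3) by blast
  qed simp
  moreover have "finite ?F" using B(1) f by blast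
  ultimately show thesis using subspace_finite_dim[OF act_sub] that by metis
qed

text \<open>The conditions are card B linear maps into the span of F, hence card B * card F scalar
  equations.\<close>

lemma codim_kernel:
  assumes "finite F" "finite B" "cv.subspace P" "\<And>u e. u \<in> P \<Longrightarrow> e \<in> B \<Longrightarrow> \<rho> u e \<in> cspan F"
  shows "codim_le (card B * card F) P {u \<in> P. \<forall>e\<in>B. \<rho> u e = 0}"
  using assms(2,4)
proof (induction B rule: finite_induct)
  case empty
  then show ?case by simp
next
  case (insert e B)
  let ?P = "{u \<in> P. \<forall>e\<in>B. \<rho> u e = 0}"
  have "cv.subspace ?P"
    by (intro cv.subspaceI) (auto simp: rho_add rho_scale cv.subspace_0 cv.subspace_add cv.subspace_scale assms(3))
  then have "codim_le (card B * card F + card F) P {u \<in> ?P. \<rho> u e = 0}"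
    using insert by (intro codim_le_kernel[where \<phi> = "\<lambda>u. \<rho> u e"] assms(1)) (auto simp: rho_add rho_scale)
  moreover have "{u \<in> ?P. \<rho> u e = 0} = {u \<in> P. \<forall>e\<in>insert e B. \<rho> u e = 0}" by auto
  ultimately show ?case using insert.hyps by (simp add: add.commute)
qed

text \<open>\<open>X m\<close> commutes with \<open>H\<close> and so acts on the finite-dimensional space \<open>act H\<close>, with kernel in \<open>Q m\<close>;
  this bounds the codimension of \<open>Q m\<close> independently of \<open>m\<close>.\<close>

definition X :: "nat \<Rightarrow> 'a set" where
  "X m = {u \<in> G m. (\<forall>j\<in>J m. br u j = 0) \<and> (\<forall>v\<in>act I. \<rho> u v \<in> act (J m))}"

definition R :: "nat \<Rightarrow> 'a set" where
  "R m = {y \<in> G m. \<forall>v\<in>act I. \<rho> y v \<in> act (J m)}"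

lemma X_sub: "cv.subspace (X m)"
  unfolding X_def
  by (intro cv.subspaceI)
    (auto simp: add_left scale_left rho_add rho_scale cv.subspace_0 cv.subspace_add cv.subspace_scale G_sub act_sub)

lemma X_act_H:
  assumes "u \<in> X m" "e \<in> act H"
  shows "\<rho> u e \<in> act H"
  using assms(2)
proof (rule act_maps[OF act_sub, rotated])
  fix h v assume h: "h \<in> H"
  then have "h \<in> J m" using H_J by blast
  then have "\<rho> u (\<rho> h v) = \<rho> h (\<rho> u v)" using rho_br[of u h v] assms(1) by (simp add: X_def)
  then show "\<rho> u (\<rho> h v) \<in> act H" using act_in[OF h] by simp
qed

lemma X_codim:
  assumes F: "finite F" "F \<subseteq> act H" "act H = cspan F"
  shows "codim_le (card F * card F) (X m) (Q m)"
proof -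
  have "codim_le (card F * card F) (X m) {u \<in> X m. \<forall>e\<in>F. \<rho> u e = 0}"
  proof (rule codim_kernel[OF F(1) F(1) X_sub])
    fix u e assume "u \<in> X m" "e \<in> F"
    then show "\<rho> u e \<in> cspan F" using X_act_H[of u m e] F(2,3) by auto
  qed
  then show ?thesis
  proof (rule codim_le_mono)
    show "{u \<in> X m. \<forall>e\<in>F. \<rho> u e = 0} \<subseteq> Q m"
    proof
      fix u assume u: "u \<in> {u \<in> X m. \<forall>e\<in>F. \<rho> u e = 0}"
      have "\<rho> u e = 0" if "e \<in> act H" for e
        using that unfolding F(3)
        by (induction rule: cv.span_induct_alt) (use u in \<open>auto simp: rho_addv rho_scalev\<close>)
      then have "\<rho> u v = 0" if "v \<in> act (J m)" for v
        using kills_act_J[of u m v] u that by (simp add: X_def)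
      then show "u \<in> Q m" using u by (simp add: Q_def X_def)
    qed
  qed
qed

text \<open>Write \<open>G m\<close> as \<open>J m\<close> plus an ideal commuting with it. The
  second component u = y - j still maps \<open>act I\<close> into \<open>act (J m)\<close>, because
  both y and j do.\<close>

lemma R_decomp:
  assumes "y \<in> R m"
  shows "\<exists>j\<in>J m. \<exists>u\<in>X m. y = j + u"
proof -
  obtain W where W: "ideal m W" "\<And>x w. x \<in> J m \<Longrightarrow> w \<in> W \<Longrightarrow> br x w = 0"
    "\<And>x. x \<in> G m \<Longrightarrow> \<exists>y\<in>J m. \<exists>w\<in>W. x = y + w"
    using ideal_complement[OF J_ideal[of m]] by metis
  have "y \<in> G m" using assms by (simp add: R_def)
  then obtain j u where ju: "j \<in> J m" "u \<in> W" "y = j + u" using W(3) by blast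
  have "br u x = 0" if "x \<in> J m" for x using W(2)[OF that ju(2)] antisym[of u x] by simp
  moreover have "\<rho> u v \<in> act (J m)" if "v \<in> act I" for v
  proof -
    have "u = y - j" using ju by simp
    then have "\<rho> u v = \<rho> y v - \<rho> j v" by (simp add: rho_diff)
    then show ?thesis
      using assms that act_in[OF ju(1)] by (simp add: R_def cv.subspace_diff[OF act_sub])
  qed
  moreover have "u \<in> G m" using idealD(2)[OF W(1)] ju(2) by blast
  ultimately have "u \<in> X m" by (simp add: X_def)
  then show ?thesis using ju by blast
qed

text \<open>By finite rank, y maps \<open>act I\<close> onto a finite-dimensional space inside the
  union of the increasing \<open>act (J m)\<close>, so one of them contains it.\<close>

lemma alg_R: "alg \<subseteq> (\<Union>m. R m)"
proof
  fix y assume y: "y \<in> alg"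
  obtain k where k: "y \<in> G k" using y by (auto simp: alg_def)
  obtain F where F: "finite F" "range (\<rho> y) \<subseteq> cspan F" using finite_rank[OF y] by blast
  define S where "S = \<rho> y ` act I"
  have "cv.subspace S"
  proof (intro cv.subspaceI)
    have "\<rho> y 0 \<in> S" unfolding S_def using cv.subspace_0[OF act_sub] by (rule imageI)
    then show "0 \<in> S" by simp
    fix a b c assume "a \<in> S" "b \<in> S"
    then obtain u v where uv: "u \<in> act I" "v \<in> act I" "a = \<rho> y u" "b = \<rho> y v"
      unfolding S_def by blast
    then have "u + v \<in> act I" "c *\<^sub>C u \<in> act I"
      using cv.subspace_add[OF act_sub] cv.subspace_scale[OF act_sub] by auto
    then have "\<rho> y (u + v) \<in> S" "\<rho> y (c *\<^sub>C u) \<in> S" unfolding S_def by (simp_all add: imageI)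
    then show "a + b \<in> S" "c *\<^sub>C a \<in> S" by (simp_all add: uv rho_addv rho_scalev)
  qed
  moreover have "S \<subseteq> cspan F" using F(2) by (auto simp: S_def)
  ultimately obtain B where B: "finite B" "B \<subseteq> S" "cspan B = S"
    using F(1) by (rule subspace_finite_dim)
  have "S \<subseteq> act I" using act_I_stable[OF y] by (auto simp: S_def)
  then have "B \<subseteq> (\<Union>m. act (J m))" using B(2) unfolding act_I_Union by (rule order_trans[rotated])
  then obtain m where m: "m \<ge> k" "B \<subseteq> act (J m)"
    using chain_finite_subset[of B "\<lambda>m. act (J m)" k, OF B(1) _ act_mono[OF J_Suc]] by metis
  then have "S \<subseteq> act (J m)" unfolding B(3)[symmetric] by (intro cv.span_minimal act_sub)
  then have "\<forall>v\<in>act I. \<rho> y v \<in> act (J m)" by (auto simp: S_def)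
  moreover have "y \<in> G m" using G_mono[OF m(1)] k by blast
  ultimately have "y \<in> R m" by (simp add: R_def)
  then show "y \<in> (\<Union>m. R m)" by blast
qed

text \<open>The bound for \<open>X m\<close> modulo \<open>Q m\<close> does not depend on m; it
  carries over to \<open>R m\<close> modulo I + Z and hence to the union of the
  \<open>R m\<close>.\<close>

lemma codim_I_Z:
  obtains n where "codim_le n alg {i + z | i z. i \<in> I \<and> z \<in> Z}"
proof -
  define IZ where "IZ = {i + z | i z. i \<in> I \<and> z \<in> Z}"
  have IZ: "cv.subspace IZ" unfolding IZ_def by (intro cv.subspace_sums I_sub Z_sub)
  have I_IZ: "x \<in> IZ" if "x \<in> I" for x
    unfolding IZ_def using that cv.subspace_0[OF Z_sub] by (intro CollectI exI[of _ x] exI[of _ 0]) simp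
  have Z_IZ: "x \<in> IZ" if "x \<in> Z" for x
    unfolding IZ_def using that cv.subspace_0[OF I_sub] by (intro CollectI exI[of _ 0] exI[of _ x]) simp
  obtain F where F: "finite F" "F \<subseteq> act H" "act H = cspan F" by (rule act_H_finite)
  have R: "codim_le (card F * card F) (R m) IZ" for m
  proof (rule codim_le_sum[OF _ IZ])
    have "Q m \<subseteq> IZ" using Q_Z Z_IZ by blast
    then show "codim_le (card F * card F) (X m) IZ" by (rule codim_le_mono[OF X_codim[OF F]])
    fix y assume "y \<in> R m"
    then obtain j u where "j \<in> J m" "u \<in> X m" "y = j + u" using R_decomp by blast
    moreover then have "j \<in> IZ" using J_I I_IZ by blast
    ultimately show "\<exists>p\<in>IZ. \<exists>x\<in>X m. y = p + x" by blast
  qed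
  have "R m \<subseteq> R (Suc m)" for m
    using G_Suc[of m] act_mono[OF J_Suc[of m]] by (auto simp: R_def)
  then have "codim_le (card F * card F) (\<Union>m. R m) IZ" by (rule codim_le_Union[OF R])
  then have "codim_le (card F * card F) alg IZ" using alg_R by (rule codim_le_subset)
  then show thesis unfolding IZ_def by (rule that)
qed

end

section \<open>Maximal locally solvable subalgebras\<close>

lemma in_sum_iff:
  fixes x :: "'a::complex_vector"
  shows "x \<in> {p + q | p q. p \<in> P \<and> q \<in> Q} \<longleftrightarrow> (\<exists>p\<in>P. x - p \<in> Q)"
proof
  assume "\<exists>p\<in>P. x - p \<in> Q"
  then obtain p where "p \<in> P" "x - p \<in> Q" ..
  moreover have "x = p + (x - p)" by simp
  ultimately show "x \<in> {p + q | p q. p \<in> P \<and> q \<in> Q}" by blast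
next
  assume "x \<in> {p + q | p q. p \<in> P \<and> q \<in> Q}"
  then obtain p q where "x = p + q" "p \<in> P" "q \<in> Q" by blast
  then show "\<exists>p\<in>P. x - p \<in> Q" by (intro bexI[of _ p]) simp_all
qed

section \<open>Local solvability tested on subspaces\<close>

context lie
begin

text \<open>The witness X is any subspace, not necessarily a finite-dimensional subalgebra of B, so
  that sums and limits can serve directly. For subalgebras of \<open>alg\<close> nothing changes
  (\<open>loc_solv_iff\<close>): B \<inter> \<open>G m\<close> is then a witness of the stricter
  kind.\<close>

definition loc_solv :: "'a set \<Rightarrow> bool" where
  "loc_solv B \<longleftrightarrow> (\<forall>F. finite F \<and> F \<subseteq> B \<longrightarrow>
     (\<exists>X n. cv.subspace X \<and> F \<subseteq> X \<and> derived_series br X n \<subseteq> {0}))"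

lemma loc_solvI:
  assumes "\<And>F. finite F \<Longrightarrow> F \<subseteq> B \<Longrightarrow> \<exists>X n. cv.subspace X \<and> F \<subseteq> X \<and> derived_series br X n \<subseteq> {0}"
  shows "loc_solv B"
  using assms unfolding loc_solv_def by blast

definition br_closed :: "'a set \<Rightarrow> bool" where
  "br_closed B \<longleftrightarrow> cv.subspace B \<and> (\<forall>x\<in>B. \<forall>y\<in>B. br x y \<in> B)"

lemma br_closedD: "br_closed B \<Longrightarrow> cv.subspace B" "br_closed B \<Longrightarrow> x \<in> B \<Longrightarrow> y \<in> B \<Longrightarrow> br x y \<in> B"
  by (auto simp: br_closed_def)

lemma br_closed_Int: "br_closed A \<Longrightarrow> br_closed B \<Longrightarrow> br_closed (A \<inter> B)"
  by (auto simp: br_closed_def cv.subspace_inter)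

lemma br_closed_sum:
  assumes P: "br_closed P" and Q: "br_closed Q" and PQ: "\<And>x y. x \<in> P \<Longrightarrow> y \<in> Q \<Longrightarrow> br x y \<in> Q"
  shows "br_closed {p + q | p q. p \<in> P \<and> q \<in> Q}"
  unfolding br_closed_def
proof (intro conjI ballI)
  show "cv.subspace {p + q | p q. p \<in> P \<and> q \<in> Q}"
    by (intro cv.subspace_sums br_closedD(1) P Q)
  fix x y assume "x \<in> {p + q | p q. p \<in> P \<and> q \<in> Q}" "y \<in> {p + q | p q. p \<in> P \<and> q \<in> Q}"
  then obtain p q p' q' where pq: "x = p + q" "p \<in> P" "q \<in> Q" "y = p' + q'" "p' \<in> P" "q' \<in> Q"
    by blast
  have "br x y = br p p' + (br p q' + (br q p' + br q q'))"
    by (simp add: pq add_left add_right)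
  moreover have "br q p' \<in> Q"
    using PQ[OF pq(5,3)] antisym[of q p'] cv.subspace_neg[OF br_closedD(1)[OF Q]] by simp
  then have "br p q' + (br q p' + br q q') \<in> Q"
    using PQ[OF pq(2,6)] br_closedD(2)[OF Q pq(3,6)] cv.subspace_add[OF br_closedD(1)[OF Q]] by simp
  moreover have "br p p' \<in> P" using br_closedD(2)[OF P pq(2,5)] .
  ultimately show "br x y \<in> {p + q | p q. p \<in> P \<and> q \<in> Q}" by blast
qed

end

context reductive_chain
begin

lemma br_closed_G: "br_closed (G m)"
  by (simp add: br_closed_def G_sub G_br)

lemma Int_G_finite_dim:
  assumes "cv.subspace B"
  shows "\<exists>S. finite S \<and> S \<subseteq> B \<inter> G m \<and> cspan S = B \<inter> G m"
proof -
  obtain F where F: "finite F" "cspan F = G m" using G_fin by blast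
  have "cv.subspace (B \<inter> G m)" using assms G_sub by (rule cv.subspace_inter)
  moreover have "B \<inter> G m \<subseteq> cspan F" unfolding F(2) by (rule Int_lower2)
  ultimately show ?thesis by (rule subspace_finite_dim[OF _ _ F(1)]) (intro exI conjI)
qed

lemma loc_solv_G:
  assumes "loc_solv B" "cv.subspace B"
  shows "\<exists>n. derived_series br (B \<inter> G m) n \<subseteq> {0}"
proof -
  obtain S where S: "finite S" "S \<subseteq> B \<inter> G m" "cspan S = B \<inter> G m"
    using Int_G_finite_dim[OF assms(2)] by metis
  then have "finite S \<and> S \<subseteq> B" by simp
  from assms(1)[unfolded loc_solv_def, rule_format, OF this]
  obtain X n where X: "cv.subspace X" "S \<subseteq> X" "derived_series br X n \<subseteq> {0}"
    by (elim exE conjE)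
  have "B \<inter> G m \<subseteq> X" unfolding S(3)[symmetric] using X(2,1) by (rule cv.span_minimal)
  then have "derived_series br (B \<inter> G m) n \<subseteq> {0}"
    by (rule order_trans[OF ds_mono X(3)])
  then show ?thesis ..
qed

lemma alg_finite_ex: "finite F \<Longrightarrow> F \<subseteq> alg \<Longrightarrow> \<exists>m. F \<subseteq> G m"
  using alg_finite by metis

lemma subalgebra_iff: "subalgebra br L B \<longleftrightarrow> br_closed B \<and> B \<subseteq> L"
  by (auto simp: subalgebra_def br_closed_def csubspace_iff)

lemma loc_solv_iff:
  assumes "br_closed B" "B \<subseteq> alg"
  shows "locally_solvable br B \<longleftrightarrow> loc_solv B"
proof
  assume B: "locally_solvable br B"
  show "loc_solv B"
  proof (rule loc_solvI)
    fix F assume "finite F" "F \<subseteq> B"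
    from B[unfolded locally_solvable_def, rule_format, OF conjI, OF this]
    obtain T where T: "subalgebra br B T" "F \<subseteq> T" "solvable br T"
      by (elim exE conjE)
    then obtain n where "derived_series br T n = {0}" unfolding solvable_def by (elim exE)
    moreover have "cv.subspace T" using T(1) by (simp add: subalgebra_def csubspace_iff)
    ultimately show "\<exists>X n. cv.subspace X \<and> F \<subseteq> X \<and> derived_series br X n \<subseteq> {0}"
      using T(2) by (intro exI[of _ T] exI[of _ n]) simp
  qed
next
  assume B: "loc_solv B"
  show "locally_solvable br B"
    unfolding locally_solvable_def
  proof (intro allI impI, elim conjE)
    fix F assume F: "finite F" "F \<subseteq> B"
    obtain m where m: "F \<subseteq> G m"
      using alg_finite_ex[OF F(1) order_trans[OF F(2) assms(2)]] by (elim exE)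
    define T where "T = B \<inter> G m"
    have c: "br_closed T" unfolding T_def by (intro br_closed_Int assms br_closed_G)
    have "finite_dim T"
      using Int_G_finite_dim[OF br_closedD(1)[OF assms(1)], of m] unfolding finite_dim_def T_def .
    moreover obtain n where n: "derived_series br T n \<subseteq> {0}"
      using loc_solv_G[OF B br_closedD(1)[OF assms(1)], of m] unfolding T_def by (elim exE)
    have "0 \<in> derived_series br T n" by (rule cv.subspace_0[OF ds_subspace[OF br_closedD(1)[OF c]]])
    then have "derived_series br T n = {0}" using n by (intro equalityI) simp_all
    then have "solvable br T" unfolding solvable_def by (rule exI)
    moreover have "subalgebra br B T" unfolding subalgebra_iff using c by (simp add: T_def)
    moreover have "F \<subseteq> T" using F(2) m by (simp add: T_def)
    ultimately show "\<exists>T. subalgebra br B T \<and> F \<subseteq> T \<and> finite_dim T \<and> solvable br T"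
      by (intro exI conjI)
  qed
qed

section \<open>Maximality arguments\<close>

definition maximal :: "'a set \<Rightarrow> bool" where
  "maximal b \<longleftrightarrow> br_closed b \<and> b \<subseteq> alg \<and> loc_solv b
     \<and> (\<forall>C. br_closed C \<and> C \<subseteq> alg \<and> loc_solv C \<and> b \<subseteq> C \<longrightarrow> C = b)"

definition ideal_alg :: "'a set \<Rightarrow> bool" where
  "ideal_alg I \<longleftrightarrow> cv.subspace I \<and> I \<subseteq> alg \<and> (\<forall>a\<in>alg. \<forall>x\<in>I. br a x \<in> I)"

lemma ideal_algD:
  assumes "ideal_alg I"
  shows "br_closed I" "I \<subseteq> alg" "cv.subspace I" "a \<in> alg \<Longrightarrow> x \<in> I \<Longrightarrow> br a x \<in> I"
  using assms by (auto simp: ideal_alg_def br_closed_def)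

lemma sum_ideal_solvable:
  assumes b: "br_closed b" "b \<subseteq> alg" and I: "ideal_alg I"
    and n: "derived_series br (b \<inter> G m) n \<subseteq> {0}"
  shows "derived_series br {p + q | p q. p \<in> b \<inter> G m \<and> q \<in> I} n \<subseteq> I"
proof -
  have "br_closed (b \<inter> G m)" by (intro br_closed_Int b br_closed_G)
  then have "derived_series br {p + q | p q. p \<in> b \<inter> G m \<and> q \<in> I} n
      \<subseteq> {p + q | p q. p \<in> derived_series br (b \<inter> G m) n \<and> q \<in> I}"
    using b(2) ideal_algD[OF I] by (intro ds_sum) (auto dest: br_closedD)
  then show ?thesis using n by fastforce
qed

text \<open>The subalgebra (b + Z) \<inter> (b + I) contains b. Modulo Z and modulo I its derived
  series locally follows that of b, so it ends in Z \<inter> I, which is abelian. By maximality the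
  subalgebra equals b.\<close>

lemma maximal_project:
  assumes b: "maximal b" and I: "ideal_alg I" and Z: "ideal_alg Z"
    and IZ: "\<And>z x. z \<in> Z \<Longrightarrow> x \<in> I \<Longrightarrow> br z x = 0"
    and y: "i + z \<in> b" "i \<in> I" "z \<in> Z"
  shows "i \<in> b"
proof -
  let ?A = "{p + q | p q. p \<in> b \<and> q \<in> Z}" and ?B = "{p + q | p q. p \<in> b \<and> q \<in> I}"
  have b': "br_closed b" "b \<subseteq> alg" "loc_solv b" using b by (auto simp: maximal_def)
  have "br_closed ?A" "br_closed ?B"
    using b' ideal_algD[OF I] ideal_algD[OF Z] by (auto intro!: br_closed_sum)
  then have "br_closed (?A \<inter> ?B)" by (rule br_closed_Int)
  moreover have "?A \<subseteq> alg"
    using b'(2) ideal_algD(2)[OF Z] cv.subspace_add[OF alg_sub] by blast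
  moreover have "loc_solv (?A \<inter> ?B)"
  proof (rule loc_solvI)
    fix F assume F: "finite F" "F \<subseteq> ?A \<inter> ?B"
    then have "\<forall>f\<in>F. (\<exists>p\<in>b. f - p \<in> Z) \<and> (\<exists>p\<in>b. f - p \<in> I)"
      unfolding subset_iff Int_iff in_sum_iff by blast
    then obtain p p' where p: "\<forall>f\<in>F. p f \<in> b \<and> f - p f \<in> Z" "\<forall>f\<in>F. p' f \<in> b \<and> f - p' f \<in> I"
      by metis
    then have "p ` F \<union> p' ` F \<subseteq> alg" using b'(2) by blast
    then obtain m where m: "p ` F \<union> p' ` F \<subseteq> G m" using alg_finite F(1) by (metis finite_UnI finite_imageI)
    obtain n where n: "derived_series br (b \<inter> G m) n \<subseteq> {0}"
      using loc_solv_G[OF b'(3) br_closedD(1)[OF b'(1)]] by metis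
    let ?X = "{p + q | p q. p \<in> b \<inter> G m \<and> q \<in> Z} \<inter> {p + q | p q. p \<in> b \<inter> G m \<and> q \<in> I}"
    have sub: "cv.subspace ?X"
      using br_closedD(1)[OF b'(1)] G_sub ideal_algD(3)[OF I] ideal_algD(3)[OF Z]
      by (intro cv.subspace_inter cv.subspace_sums)
    have "F \<subseteq> ?X"
    proof
      fix f assume f: "f \<in> F"
      have "p f \<in> b \<inter> G m" "p' f \<in> b \<inter> G m" using p m f by auto
      then show "f \<in> ?X" unfolding Int_iff[of f "{p + q |p q. p \<in> b \<inter> G m \<and> q \<in> Z}"] in_sum_iff using p f by blast
    qed
    moreover have "derived_series br ?X n \<subseteq> Z" "derived_series br ?X n \<subseteq> I"
      by (rule order_trans[OF ds_mono[OF Int_lower1] sum_ideal_solvable[OF b'(1,2) Z n]],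
          rule order_trans[OF ds_mono[OF Int_lower2] sum_ideal_solvable[OF b'(1,2) I n]])
    then have "brset br (derived_series br ?X n) (derived_series br ?X n) \<subseteq> {0}"
      using IZ by (intro brset_least) auto
    then have "derived_series br ?X (Suc n) \<subseteq> {0}" by (simp add: derived_def)
    ultimately show "\<exists>X n. cv.subspace X \<and> F \<subseteq> X \<and> derived_series br X n \<subseteq> {0}"
      using sub by blast
  qed
  moreover have "b \<subseteq> ?A \<inter> ?B"
  proof
    fix x assume "x \<in> b"
    moreover have "x - x \<in> I" "x - x \<in> Z"
      using cv.subspace_0[OF ideal_algD(3)[OF I]] cv.subspace_0[OF ideal_algD(3)[OF Z]] by simp_all
    ultimately show "x \<in> ?A \<inter> ?B" unfolding Int_iff in_sum_iff by blast
  qed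
  ultimately have eq: "?A \<inter> ?B = b" using b unfolding maximal_def by (meson le_infI1)
  \<comment> \<open>i = (i + z) - z lies in b + Z, and i = 0 + i lies in b + I.\<close>
  have "i - (i + z) \<in> Z" using cv.subspace_neg[OF ideal_algD(3)[OF Z] y(3)] by simp
  moreover have "i - 0 \<in> I" "0 \<in> b" using y(2) cv.subspace_0[OF br_closedD(1)[OF b'(1)]] by simp_all
  ultimately have "i \<in> ?A \<inter> ?B"
    using y(1) unfolding Int_iff in_sum_iff by blast
  then show ?thesis using eq by simp
qed

text \<open>D is an ideal of the subalgebra b + D, so local solvability of b and of D gives that of
  b + D, with the derived lengths n and k of the pieces in \<open>G m\<close> adding up.\<close>

lemma maximal_stable:
  assumes b: "maximal b" and D: "br_closed D" "D \<subseteq> alg" "loc_solv D"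
    and bD: "\<And>x y. x \<in> b \<Longrightarrow> y \<in> D \<Longrightarrow> br x y \<in> D"
  shows "D \<subseteq> b"
proof -
  let ?A = "{p + q | p q. p \<in> b \<and> q \<in> D}"
  have b': "br_closed b" "b \<subseteq> alg" "loc_solv b" using b by (auto simp: maximal_def)
  have "br_closed ?A" by (intro br_closed_sum b' D bD)
  moreover have "?A \<subseteq> alg" using b'(2) D(2) cv.subspace_add[OF alg_sub] by blast
  moreover have "loc_solv ?A"
  proof (rule loc_solvI)
    fix F assume F: "finite F" "F \<subseteq> ?A"
    then have "\<forall>f\<in>F. \<exists>p\<in>b. f - p \<in> D" unfolding subset_iff in_sum_iff by blast
    then obtain p where p: "\<forall>f\<in>F. p f \<in> b \<and> f - p f \<in> D" by metis
    then have "p ` F \<union> (\<lambda>f. f - p f) ` F \<subseteq> alg" using b'(2) D(2) by blast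
    then obtain m where m: "p ` F \<union> (\<lambda>f. f - p f) ` F \<subseteq> G m" using alg_finite F(1) by (metis finite_UnI finite_imageI)
    obtain n where n: "derived_series br (b \<inter> G m) n \<subseteq> {0}"
      using loc_solv_G[OF b'(3) br_closedD(1)[OF b'(1)]] by metis
    obtain k where k: "derived_series br (D \<inter> G m) k \<subseteq> {0}"
      using loc_solv_G[OF D(3) br_closedD(1)[OF D(1)]] by metis
    let ?X = "{p + q | p q. p \<in> b \<inter> G m \<and> q \<in> D \<inter> G m}"
    have c: "br_closed (b \<inter> G m)" "br_closed (D \<inter> G m)" by (intro br_closed_Int b' D br_closed_G)+
    have "derived_series br ?X n \<subseteq> {p + q | p q. p \<in> derived_series br (b \<inter> G m) n \<and> q \<in> D \<inter> G m}"
      using c bD G_br by (intro ds_sum) (auto dest: br_closedD)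
    then have "derived_series br ?X n \<subseteq> D \<inter> G m" using n by fastforce
    then have "derived_series br ?X (n + k) \<subseteq> {0}"
      unfolding ds_add using ds_mono k by blast
    moreover have "cv.subspace ?X" using c br_closedD(1) by (intro cv.subspace_sums)
    moreover have "F \<subseteq> ?X" unfolding subset_iff in_sum_iff using p m by blast
    ultimately show "\<exists>X n. cv.subspace X \<and> F \<subseteq> X \<and> derived_series br X n \<subseteq> {0}" by blast
  qed
  moreover have "b \<subseteq> ?A"
  proof
    fix x assume "x \<in> b"
    moreover have "x - x \<in> D" using cv.subspace_0[OF br_closedD(1)[OF D(1)]] by simp
    ultimately show "x \<in> ?A" unfolding in_sum_iff by blast
  qed
  ultimately have "?A = b" using b unfolding maximal_def by meson
  moreover have "D \<subseteq> ?A"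
  proof
    fix x assume "x \<in> D"
    then have "x - 0 \<in> D" by simp
    moreover have "0 \<in> b" by (rule cv.subspace_0[OF br_closedD(1)[OF b'(1)]])
    ultimately show "x \<in> ?A" unfolding in_sum_iff by blast
  qed
  ultimately show ?thesis by simp
qed

text \<open>One deformation adds y to the elements that normalize D. The last implication carries
  the inclusion in b, once it is known for D', back to D.\<close>

lemma deform_step:
  assumes b: "br_closed b" "b \<subseteq> alg" and y: "y \<in> b" and I: "ideal_alg I"
    and M: "cv.subspace M" "M \<subseteq> b" "\<And>x. x \<in> M \<Longrightarrow> br y x \<in> M"
    and D: "br_closed D" "D \<subseteq> I" "loc_solv D" "b \<inter> I \<subseteq> D" "\<And>x z. x \<in> M \<Longrightarrow> z \<in> D \<Longrightarrow> br x z \<in> D"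
  shows "\<exists>D'. br_closed D' \<and> D' \<subseteq> I \<and> loc_solv D' \<and> b \<inter> I \<subseteq> D'
    \<and> (\<forall>x\<in>cspan (insert y M). \<forall>z\<in>D'. br x z \<in> D') \<and> (D' \<subseteq> b \<longrightarrow> D \<subseteq> b)"
proof -
  have yalg: "y \<in> alg" using b y by blast
  then obtain k where k: "y \<in> G k" by (auto simp: alg_def)
  interpret der: lie_derivation br "br y"
    by unfold_locales (rule add_right scale_right leibniz)+
  define G' where "G' = (\<lambda>m. G (k + m))"
  have yG: "y \<in> G' m" for m using G_mono[OF le_add1[of k m]] k by (auto simp: G'_def)
  have Ginv: "der.d_inv (G' m)" for m
    using yG[of m] G_br by (auto simp: der.d_inv_def G_sub G'_def)
  have G'_Suc: "G' m \<subseteq> G' (Suc m)" for m using G_Suc[of "k + m"] by (simp add: G'_def)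
  have alg: "alg = (\<Union>m. G' m)"
  proof
    show "alg \<subseteq> (\<Union>m. G' m)"
    proof
      fix x assume "x \<in> alg"
      then obtain m where "x \<in> G m" by (auto simp: alg_def)
      then have "x \<in> G' m" using G_mono[OF le_add2[of m k]] by (auto simp: G'_def)
      then show "x \<in> (\<Union>m. G' m)" by blast
    qed
  qed (auto simp: alg_def G'_def)
  have Gfin: "\<exists>F. finite F \<and> G' m \<subseteq> cspan F" for m
    using G_fin[of "k + m"] unfolding G'_def by (metis order_refl)
  have gspace: "alg \<subseteq> der.gspace"
    unfolding alg
  proof (rule UN_least)
    fix m
    obtain F where "finite F" "G' m \<subseteq> cspan F" using Gfin by metis
    then show "G' m \<subseteq> der.gspace" using Ginv by (rule der.finite_dim_gspace)
  qed
  have Ialg: "I \<subseteq> alg" by (rule ideal_algD(2)[OF I])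
  have Iinv: "der.d_inv I" unfolding der.d_inv_def using ideal_algD(3,4)[OF I] yalg by simp
  have Einv: "der.d_inv (b \<inter> I)"
    unfolding der.d_inv_def using ideal_algD(3,4)[OF I] yalg br_closedD[OF b(1)] y by (simp add: cv.subspace_inter)
  have Minv: "der.d_inv M" unfolding der.d_inv_def using M by simp
  have "fix": "der.deform X = X" if "der.d_inv X" "X \<subseteq> alg" for X
    by (rule der.deform_of_inv[OF that(1) order_trans[OF that(2) gspace]])
  have Dsub: "cv.subspace D" by (rule br_closedD(1)[OF D(1)])
  have Dalg: "D \<subseteq> alg" by (rule order_trans[OF D(2) Ialg])
  define D' where "D' = der.deform D"
  have D'_sub: "cv.subspace D'" unfolding D'_def by (rule der.d_invD(1)[OF der.deform_inv])
  have br_D: "br x z \<in> D'" if "x \<in> der.deform X" "z \<in> D'" "brset br X D \<subseteq> D" for x z X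
    using der.deform_br[OF that(1) that(2)[unfolded D'_def]] der.deform_mono[OF that(3)]
    unfolding D'_def by (rule rev_subsetD)
  have "brset br D D \<subseteq> D" by (rule brset_least[OF Dsub br_closedD(2)[OF D(1)]])
  then have c: "br_closed D'" unfolding br_closed_def using D'_sub br_D[of _ D] by (simp add: D'_def)
  have DI: "D' \<subseteq> I" using der.deform_mono[OF D(2)] unfolding "fix"[OF Iinv Ialg] D'_def .
  have ED: "b \<inter> I \<subseteq> D'"
    using der.deform_mono[OF D(4)] unfolding "fix"[OF Einv le_infI1[OF b(2)]] D'_def .
  have MD: "br u v \<in> D'" if uM: "u \<in> cspan (insert y M)" and vD: "v \<in> D'" for u v
  proof (rule br_span_span[OF D'_sub _ uM])
    show "v \<in> cspan D'" using vD by (rule cv.span_base)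
    fix u v assume u: "u \<in> insert y M" and v: "v \<in> D'"
    show "br u v \<in> D'"
    proof (cases "u = y")
      case True
      then show ?thesis using der.d_invD(2)[OF der.deform_inv] v unfolding D'_def by simp
    next
      case False
      \<comment> \<open>M is its own limit since y normalizes it, so [M, D'] lies in the limit of
        [M, D], hence in D'.\<close>
      then have "u \<in> der.deform M" using u unfolding "fix"[OF Minv order_trans[OF M(2) b(2)]] by simp
      moreover have "brset br M D \<subseteq> D" by (rule brset_least[OF Dsub D(5)])
      ultimately show ?thesis using v br_D by metis
    qed
  qed
  have ls: "loc_solv D'"
  proof (rule loc_solvI)
    fix F assume F: "finite F" "F \<subseteq> D'"
    have "F \<subseteq> (\<Union>m. der.deform (D \<inter> G' m))"
    proof
      fix w assume "w \<in> F"
      then have w: "w \<in> der.deform D" using F(2) by (auto simp: D'_def)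
      have "\<exists>m. w \<in> der.deform (D \<inter> G' m)"
        by (rule der.deform_chain[of G' D w, OF Ginv G'_Suc Gfin Dalg[unfolded alg] gspace[unfolded alg] w])
      then show "w \<in> (\<Union>m. der.deform (D \<inter> G' m))" by blast
    qed
    moreover have "der.deform (D \<inter> G' m) \<subseteq> der.deform (D \<inter> G' (Suc m))" for m
      by (rule der.deform_mono[OF Int_mono[OF order_refl G'_Suc]])
    ultimately obtain m where m: "F \<subseteq> der.deform (D \<inter> G' m)"
      using chain_finite_subset[OF F(1), of "\<lambda>m. der.deform (D \<inter> G' m)"] by metis
    obtain n where n: "derived_series br (D \<inter> G' m) n \<subseteq> {0}"
      using loc_solv_G[OF D(3) Dsub, of "k + m"] unfolding G'_def by (elim exE)
    have "der.d_inv {0}" by (simp add: der.d_inv_def)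
    then have "der.deform {0} = {0}" using cv.subspace_0[OF alg_sub] by (intro "fix") simp_all
    then have "derived_series br (der.deform (D \<inter> G' m)) n \<subseteq> {0}"
      using der.ds_deform[of "D \<inter> G' m" n] der.deform_mono[OF n] by simp
    then show "\<exists>X n. cv.subspace X \<and> F \<subseteq> X \<and> derived_series br X n \<subseteq> {0}"
      using m der.d_invD(1)[OF der.deform_inv[of "D \<inter> G' m"]] by (intro exI conjI)
  qed
  \<comment> \<open>If D' lies in b, it lies in the y-stable subspace b \<inter> I of D, and then D
    itself cannot be larger than b \<inter> I.\<close>
  have "D \<subseteq> b" if "D' \<subseteq> b"
  proof -
    have "der.deform D \<subseteq> b \<inter> I" using that DI by (simp add: D'_def)
    then have "D \<subseteq> b \<inter> I"
      by (rule der.deform_reverse[OF Dsub order_trans[OF Dalg gspace] Einv _ D(4)])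
    then show ?thesis by simp
  qed
  then show ?thesis using c DI ED MD ls by (intro exI[of _ D']) simp
qed

text \<open>As M contains [b, b], every subspace between M and b is an ideal of b. So y normalizes
  M, and adjoining y keeps this property; each deformation uses up one unit of codimension until D
  is stable under b.\<close>

lemma maximal_deform:
  assumes b: "maximal b" and I: "ideal_alg I"
    and "codim_le n b M" "cv.subspace M" "M \<subseteq> b" "\<And>x y. x \<in> b \<Longrightarrow> y \<in> b \<Longrightarrow> br x y \<in> M"
    and "br_closed D" "D \<subseteq> I" "loc_solv D" "b \<inter> I \<subseteq> D"
    and "\<And>x y. x \<in> M \<Longrightarrow> y \<in> D \<Longrightarrow> br x y \<in> D"
  shows "D \<subseteq> b"
  using assms(3-)
proof (induction n arbitrary: M D)
  case 0
  then have "b \<subseteq> M" by simp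
  then show ?case
    using maximal_stable[OF b 0(5) order_trans[OF 0(6) ideal_algD(2)[OF I]] 0(7)] 0(9) by blast
next
  case (Suc n)
  have b': "br_closed b" "b \<subseteq> alg" using b by (auto simp: maximal_def)
  show ?case
  proof (cases "b \<subseteq> M")
    case True
    then show ?thesis
      using maximal_stable[OF b Suc.prems(5) order_trans[OF Suc.prems(6) ideal_algD(2)[OF I]] Suc.prems(7)]
        Suc.prems(9) by blast
  next
    case False
    then obtain y where y: "y \<in> b" "y \<notin> M" by blast
    have yM: "br y x \<in> M" if "x \<in> M" for x using Suc.prems(3,4) y(1) that by blast
    from deform_step[OF b' y(1) I Suc.prems(2,3) yM Suc.prems(5-9)]
    obtain D' where D': "br_closed D'" "D' \<subseteq> I" "loc_solv D'" "b \<inter> I \<subseteq> D'"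
      "\<forall>x\<in>cspan (insert y M). \<forall>z\<in>D'. br x z \<in> D'" "D' \<subseteq> b \<longrightarrow> D \<subseteq> b"
      by metis
    have "D' \<subseteq> b"
    proof (rule Suc.IH[OF _ _ _ _ D'(1-4)])
      show "codim_le n b (cspan (insert y M))" using Suc.prems(1) y by simp
      show "cspan (insert y M) \<subseteq> b" using y Suc.prems(3) br_closedD(1)[OF b'(1)] by (intro cv.span_minimal) auto
      show "br u v \<in> cspan (insert y M)" if "u \<in> b" "v \<in> b" for u v
        using Suc.prems(4)[OF that] by (intro cv.span_base) simp
    qed (use D'(5) in auto)
    then show ?thesis using D'(6) by simp
  qed
qed

lemma derived_alg_Union: "derived br alg \<subseteq> (\<Union>m. derived br (G m))"
  unfolding derived_def[of br alg]
proof (rule brset_least)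
  show "cv.subspace (\<Union>m. derived br (G m))"
    unfolding derived_def by (intro subspace_Union_chain brset_subspace brset_mono G_Suc)
  fix x y assume "x \<in> alg" "y \<in> alg"
  then obtain m where "x \<in> G m" "y \<in> G m" by (rule alg_pair)
  then have "br x y \<in> derived br (G m)" unfolding derived_def by (intro brset_in) auto
  then show "br x y \<in> (\<Union>m. derived br (G m))" by blast
qed

lemma derived_G_alg: "derived br (G m) \<subseteq> derived br alg"
  unfolding derived_def by (intro brset_mono) (auto simp: alg_def)

end

section \<open>The derived algebra of a finitary chain\<close>

context finitary_chain
begin

lemma ideal_alg_I: "ideal_alg I"
  by (simp add: ideal_alg_def I_sub I_alg I_stable)

lemma ideal_alg_Z: "ideal_alg Z"
proof -
  have "Z \<subseteq> alg" by (auto simp: Z_def)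
  then show ?thesis by (simp add: ideal_alg_def Z_sub Z_stable)
qed

lemma I_derived: "I \<subseteq> derived br alg"
  using J_derived derived_G_alg by (fastforce simp: I_def)

text \<open>The estimate concerns the ideal generated by the derived algebra of the first term.
  Starting the chain at a term whose derived algebra contains x leaves \<open>alg\<close> unchanged
  and puts x into that ideal.\<close>

lemma finite_codim_ideal:
  assumes "x \<in> derived br alg"
  shows "\<exists>K Y n. ideal_alg K \<and> ideal_alg Y \<and> (\<forall>z\<in>Y. \<forall>y\<in>K. br z y = 0)
    \<and> K \<subseteq> derived br alg \<and> x \<in> K \<and> codim_le n alg {i + z | i z. i \<in> K \<and> z \<in> Y}"
proof -
  obtain k where k: "x \<in> derived br (G k)" using assms derived_alg_Union by blast
  interpret sh: reductive_chain br "\<lambda>m. G (k + m)"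
    by unfold_locales (use G_sub G_br G_fin G_Suc G_red G_red_Suc in auto)
  have alg: "sh.alg = alg"
    using G_mono[OF le_add2] by (fastforce simp: alg_def sh.alg_def)
  interpret sh: finitary_chain br "\<lambda>m. G (k + m)" \<rho>
    by unfold_locales
      (use rho_add rho_scale rho_addv rho_scalev rho_br faithful finite_rank in \<open>auto simp: alg\<close>)
  obtain n where "codim_le n sh.alg {i + z | i z. i \<in> sh.I \<and> z \<in> sh.Z}" by (rule sh.codim_I_Z)
  moreover have "x \<in> sh.I" using k sh.H_J sh.J_I by (auto simp: sh.H_def)
  moreover have "\<forall>z\<in>sh.Z. \<forall>y\<in>sh.I. br z y = 0" by (simp add: sh.Z_def)
  moreover have "ideal_alg sh.I" "ideal_alg sh.Z"
    using sh.ideal_alg_I sh.ideal_alg_Z unfolding ideal_alg_def sh.ideal_alg_def alg .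
  ultimately show ?thesis using sh.I_derived unfolding alg by (intro exI conjI)
qed

lemma maximal_derived:
  assumes b: "maximal b" and C: "br_closed C" "C \<subseteq> derived br alg" "loc_solv C" "b \<inter> derived br alg \<subseteq> C"
  shows "C \<subseteq> b"
proof
  fix x assume x: "x \<in> C"
  define s where "s = derived br alg"
  have b': "br_closed b" "b \<subseteq> alg" using b by (auto simp: maximal_def)
  have b_sub: "cv.subspace b" by (rule br_closedD(1)[OF b'(1)])
  have s_sub: "cv.subspace s" unfolding s_def by (rule derived_sub)
  have "x \<in> derived br alg" using x C(2) by blast
  from finite_codim_ideal[OF this]
  obtain K Y n where K: "ideal_alg K" "ideal_alg Y" and KY: "\<forall>z\<in>Y. \<forall>y\<in>K. br z y = 0" and K':
    "K \<subseteq> derived br alg" "x \<in> K" "codim_le n alg {i + z | i z. i \<in> K \<and> z \<in> Y}"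
    by (elim exE conjE)
  define P where "P = {i + z | i z. i \<in> K \<and> z \<in> Y}"
  \<comment> \<open>The summand b \<inter> s ensures that M contains [b, b], as the induction in
    \<open>maximal_deform\<close> requires.\<close>
  define M where "M = {p + q | p q. p \<in> b \<inter> P \<and> q \<in> b \<inter> s}"
  have P_sub: "cv.subspace P"
    unfolding P_def using ideal_algD(3)[OF K(1)] ideal_algD(3)[OF K(2)] by (rule cv.subspace_sums)
  have bP: "cv.subspace (b \<inter> P)" and bs: "cv.subspace (b \<inter> s)"
    by (intro cv.subspace_inter b_sub P_sub s_sub)+
  have M_sub: "cv.subspace M" unfolding M_def using bP bs by (rule cv.subspace_sums)
  have 1: "u \<in> M" if "u \<in> b \<inter> P" for u
    unfolding M_def in_sum_iff using that cv.subspace_0[OF bs] by (intro bexI[of _ u]) simp_all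
  have 2: "u \<in> M" if "u \<in> b \<inter> s" for u
    unfolding M_def in_sum_iff using that cv.subspace_0[OF bP] by (intro bexI[of _ 0]) simp_all
  have Mb: "M \<subseteq> b" unfolding M_def using cv.subspace_add[OF b_sub] by blast
  have sC: "br c v \<in> C \<inter> K" if c: "c \<in> b \<inter> s" and v: "v \<in> C \<inter> K" for c v
  proof
    have "c \<in> C" using c C(4) by (auto simp: s_def)
    then show "br c v \<in> C" using br_closedD(2)[OF C(1)] v by simp
    have "c \<in> alg" using c b'(2) by blast
    then show "br c v \<in> K" using ideal_algD(4)[OF K(1)] v by simp
  qed
  have CK: "br_closed (C \<inter> K)" by (intro br_closed_Int C ideal_algD(1)[OF K(1)])
  have "C \<inter> K \<subseteq> b"
  proof (rule maximal_deform[OF b K(1) _ M_sub Mb _ CK Int_lower2])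
    have "codim_le n b P" unfolding P_def using K'(3) b'(2) by (rule codim_le_subset)
    then have "codim_le n b (b \<inter> P)" using b_sub P_sub by (rule codim_le_Int)
    then show "codim_le n b M" by (rule codim_le_mono) (use 1 in blast)
    show "br u v \<in> M" if "u \<in> b" "v \<in> b" for u v
    proof (rule 2)
      have "u \<in> alg" "v \<in> alg" using that b'(2) by auto
      then show "br u v \<in> b \<inter> s"
        using br_closedD(2)[OF b'(1) that] unfolding s_def derived_def by (simp add: brset_in)
    qed
    show "loc_solv (C \<inter> K)" using C(3) by (simp add: loc_solv_def)
    show "b \<inter> K \<subseteq> C \<inter> K" using C(4) K'(1) by blast
    show "br u v \<in> C \<inter> K" if u: "u \<in> M" and v: "v \<in> C \<inter> K" for u v
    proof -
      obtain p q where pq: "u = p + q" "p \<in> b" "p \<in> P" "q \<in> b \<inter> s"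
        using u unfolding M_def by blast
      obtain i z where iz: "p = i + z" "i \<in> K" "z \<in> Y" using pq(3) unfolding P_def by blast
      \<comment> \<open>The Y-component of p acts as zero on K, and the K-component i lies in b
        \<inter> s, hence in C.\<close>
      have "i \<in> b" by (rule maximal_project[OF b K(1,2) KY[rule_format] _ iz(2,3)]) (use pq(2) iz(1) in simp_all)
      then have "i \<in> b \<inter> s" using iz(2) K'(1) by (auto simp: s_def)
      then have "br i v + br q v \<in> C \<inter> K"
        using cv.subspace_add[OF br_closedD(1)[OF CK]] sC[OF _ v] pq(4) by blast
      moreover have "br z v = 0" using KY iz(3) v by simp
      ultimately show ?thesis by (simp add: pq(1) iz(1) add_left)
    qed
  qed
  then show "x \<in> b" using x K'(2) by blast
qed

lemma borel_derived:
  assumes "borel br alg b"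
  shows "borel br (derived br alg) (b \<inter> derived br alg)"
proof -
  define s where "s = derived br alg"
  have b': "br_closed b" "b \<subseteq> alg" and ls: "locally_solvable br b"
    and max: "\<And>C. br_closed C \<and> C \<subseteq> alg \<Longrightarrow> locally_solvable br C \<Longrightarrow> b \<subseteq> C \<Longrightarrow> C = b"
    using assms unfolding borel_def subalgebra_iff by simp_all
  have b: "maximal b"
    unfolding maximal_def using b' ls max loc_solv_iff by simp
  have s_alg: "s \<subseteq> alg" unfolding s_def derived_def by (intro brset_least alg_sub alg_br)
  have "br u v \<in> s" if "u \<in> s" "v \<in> s" for u v
    unfolding s_def derived_def using that s_alg by (intro brset_in) auto
  then have s: "br_closed s" unfolding br_closed_def s_def by (simp add: derived_sub)
  have c: "br_closed (b \<inter> s)" using b'(1) s by (rule br_closed_Int)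
  have "loc_solv (b \<inter> s)"
    using b unfolding maximal_def by (simp add: loc_solv_def)
  then have "locally_solvable br (b \<inter> s)" using loc_solv_iff[OF c le_infI1[OF b'(2)]] by simp
  moreover have "C = b \<inter> s" if C: "br_closed C" "C \<subseteq> s" "locally_solvable br C" "b \<inter> s \<subseteq> C" for C
  proof -
    have "loc_solv C" using loc_solv_iff[OF C(1) order_trans[OF C(2) s_alg]] C(3) by simp
    then have "C \<subseteq> b" using maximal_derived[OF b C(1)] C(2,4) unfolding s_def by simp
    then show ?thesis using C(2,4) by (intro equalityI) simp_all
  qed
  ultimately show ?thesis using c unfolding borel_def subalgebra_iff s_def by simp
qed

end

section \<open>Independence of the bracket outside the algebra\<close>

locale same_bracket =
  fixes br br' :: "'a::complex_vector \<Rightarrow> 'a \<Rightarrow> 'a" and g :: "'a set"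
  assumes same: "x \<in> g \<Longrightarrow> y \<in> g \<Longrightarrow> br' x y = br x y"
    and g_sub: "cv.subspace g"
    and g_br: "x \<in> g \<Longrightarrow> y \<in> g \<Longrightarrow> br x y \<in> g"
begin

lemma derived_same: "X \<subseteq> g \<Longrightarrow> derived br' X = derived br X"
proof -
  assume "X \<subseteq> g"
  then have "{br' x y | x y. x \<in> X \<and> y \<in> X} = {br x y | x y. x \<in> X \<and> y \<in> X}"
    using same by (metis (no_types, lifting) subsetD)
  then show ?thesis by (simp add: derived_def brset_def)
qed

lemma derived_g: "X \<subseteq> g \<Longrightarrow> derived br X \<subseteq> g"
  unfolding derived_def brset_def using g_br g_sub by (intro cv.span_minimal) blast+

lemma ds_same: "X \<subseteq> g \<Longrightarrow> derived_series br' X n = derived_series br X n \<and> derived_series br X n \<subseteq> g"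
  by (induction n) (use derived_same derived_g in auto)

lemma subalgebra_same: "L \<subseteq> g \<Longrightarrow> subalgebra br' L S \<longleftrightarrow> subalgebra br L S"
  using same unfolding subalgebra_def by (metis subsetD)

lemma locally_solvable_same:
  assumes "B \<subseteq> g"
  shows "locally_solvable br' B \<longleftrightarrow> locally_solvable br B"
proof -
  have "solvable br' T \<longleftrightarrow> solvable br T" if "subalgebra br B T" for T
  proof -
    have "T \<subseteq> g" using that assms unfolding subalgebra_def by auto
    then show ?thesis by (simp add: solvable_def ds_same)
  qed
  then show ?thesis
    unfolding locally_solvable_def subalgebra_same[OF assms] by blast
qed

lemma borel_same:
  assumes "L \<subseteq> g"
  shows "borel br' L B \<longleftrightarrow> borel br L B"
proof -
  have "C \<subseteq> g" if "subalgebra br L C" for C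
    using that assms unfolding subalgebra_def by auto
  then have "(subalgebra br L C \<and> locally_solvable br' C) \<longleftrightarrow> (subalgebra br L C \<and> locally_solvable br C)" for C
    using locally_solvable_same[of C] by (cases "subalgebra br L C") simp_all
  then show ?thesis
    by (simp only: borel_def subalgebra_same[OF assms] conj_assoc[symmetric])
qed

lemma reductive_in_same:
  assumes "A \<subseteq> g" "B \<subseteq> g"
  shows "reductive_in br' A B \<longleftrightarrow> reductive_in br A B"
proof -
  have "ad_stable br' A U \<longleftrightarrow> ad_stable br A U" if "U \<subseteq> B" for U
    using same assms that unfolding ad_stable_def by (metis subsetD)
  then show ?thesis unfolding reductive_in_def by blast
qed

end

text \<open>Composing with a projection onto \<open>g\<close> turns the bracket and the representation of \<open>g\<close> into total
  multilinear operations.\<close>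

lemma linear_projection:
  assumes "cv.subspace (g :: 'a::complex_vector set)"
  obtains \<pi> where "\<And>x y. \<pi> (x + y) = \<pi> x + \<pi> y" "\<And>c x. \<pi> (c *\<^sub>C x) = c *\<^sub>C \<pi> x" "\<And>x. \<pi> x \<in> g"
    "\<And>x. x \<in> g \<Longrightarrow> \<pi> x = x"
proof -
  interpret vector_space_pair "scaleC :: complex \<Rightarrow> 'a \<Rightarrow> 'a" "scaleC :: complex \<Rightarrow> 'a \<Rightarrow> 'a" ..
  have "Vector_Spaces.linear scaleC scaleC (\<lambda>x::'a. x)"
    by (rule cv.linear_id[unfolded id_def])
  then obtain p where p: "p ` UNIV \<subseteq> g" "Vector_Spaces.linear scaleC scaleC p" "\<forall>v\<in>g. p v = v"
    using linear_exists_left_inverse_on[OF _ assms, of "\<lambda>x. x"] by (auto simp: inj_on_def)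
  show thesis
    by (rule that[of p]) (use p linear_add[OF p(2)] linear_scale[OF p(2)] in auto)
qed

lemma lie_algebraD:
  assumes "lie_algebra br g"
  shows "cv.subspace g"
    and "x \<in> g \<Longrightarrow> y \<in> g \<Longrightarrow> br x y \<in> g"
    and "x \<in> g \<Longrightarrow> y \<in> g \<Longrightarrow> z \<in> g \<Longrightarrow> br (x + y) z = br x z + br y z"
    and "x \<in> g \<Longrightarrow> y \<in> g \<Longrightarrow> z \<in> g \<Longrightarrow> br z (x + y) = br z x + br z y"
    and "x \<in> g \<Longrightarrow> y \<in> g \<Longrightarrow> br (c *\<^sub>C x) y = c *\<^sub>C br x y"
    and "x \<in> g \<Longrightarrow> y \<in> g \<Longrightarrow> br x (c *\<^sub>C y) = c *\<^sub>C br x y"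
    and "x \<in> g \<Longrightarrow> br x x = 0"
    and "x \<in> g \<Longrightarrow> y \<in> g \<Longrightarrow> z \<in> g \<Longrightarrow> br x (br y z) + br y (br z x) + br z (br x y) = 0"
  using assms[unfolded lie_algebra_def csubspace_iff] by meson+

lemma faithful_repD:
  assumes "faithful_rep br g \<rho>"
  shows "x \<in> g \<Longrightarrow> \<rho> x (u + v) = \<rho> x u + \<rho> x v"
    and "x \<in> g \<Longrightarrow> \<rho> x (c *\<^sub>C u) = c *\<^sub>C \<rho> x u"
    and "x \<in> g \<Longrightarrow> y \<in> g \<Longrightarrow> \<rho> (x + y) u = \<rho> x u + \<rho> y u"
    and "x \<in> g \<Longrightarrow> \<rho> (c *\<^sub>C x) u = c *\<^sub>C \<rho> x u"
    and "x \<in> g \<Longrightarrow> y \<in> g \<Longrightarrow> \<rho> (br x y) u = \<rho> x (\<rho> y u) - \<rho> y (\<rho> x u)"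
    and "inj_on \<rho> g"
  using assms unfolding faithful_rep_def by simp_all

theorem theorem7p1:
  fixes br :: "'a::complex_vector \<Rightarrow> 'a \<Rightarrow> 'a" and g b :: "'a set"
  assumes "lie_algebra br g"
    and "countable_dim g"
    and "finitary TYPE('v::complex_vector) br g"
    and "locally_reductive br g"
    and "borel br g b"
  shows "borel br (derived br g) (b \<inter> derived br g)"
proof -
  note L = lie_algebraD[OF assms(1)]
  obtain \<pi> where \<pi>: "\<And>x y. \<pi> (x + y) = \<pi> x + \<pi> y" "\<And>c x. \<pi> (c *\<^sub>C x) = c *\<^sub>C \<pi> x" "\<And>x. \<pi> x \<in> g"
    "\<And>x. x \<in> g \<Longrightarrow> \<pi> x = x"
    using linear_projection[OF L(1)] by metis
  obtain \<rho> :: "'a \<Rightarrow> 'v \<Rightarrow> 'v" and Bs where \<rho>: "faithful_rep br g \<rho>" "\<forall>x\<in>g. finite_matrix Bs (\<rho> x)"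
    using assms(3) unfolding finitary_def by (elim exE conjE)
  obtain G where G: "\<And>n::nat. subalgebra br g (G n) \<and> finite_dim (G n) \<and> reductive br (G n)"
    "\<And>n. G n \<subseteq> G (Suc n)" "\<And>n. reductive_in br (G n) (G (Suc n))" "(\<Union>n. G n) = g"
    using assms(4) unfolding locally_reductive_def by metis
  define br' where "br' = (\<lambda>x y. br (\<pi> x) (\<pi> y))"
  define \<rho>' where "\<rho>' = (\<lambda>x. \<rho> (\<pi> x))"
  have Gg: "G n \<subseteq> g" for n using G(4) by blast
  interpret sb: same_bracket br br' g
    by unfold_locales (simp_all add: br'_def \<pi>(4) L(1,2))
  interpret lie br'
  proof
    fix x y z :: 'a and c
    show "br' (x + y) z = br' x z + br' y z" "br' z (x + y) = br' z x + br' z y"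
      by (simp_all add: br'_def \<pi>(1,3) L(3,4))
    show "br' (c *\<^sub>C x) y = c *\<^sub>C br' x y" "br' x (c *\<^sub>C y) = c *\<^sub>C br' x y"
      by (simp_all add: br'_def \<pi>(2,3) L(5,6))
    show "br' x x = 0" by (simp add: br'_def \<pi>(3) L(7))
    have "br (\<pi> x) (br (\<pi> y) (\<pi> z)) + br (\<pi> y) (br (\<pi> z) (\<pi> x)) + br (\<pi> z) (br (\<pi> x) (\<pi> y)) = 0"
      by (intro L(8) \<pi>(3))
    then show "br' x (br' y z) + br' y (br' z x) + br' z (br' x y) = 0"
      by (simp add: br'_def \<pi>(3,4) L(2))
  qed
  interpret rc: reductive_chain br' G
  proof
    fix m x y
    show "cv.subspace (G m)" using G(1) by (simp add: subalgebra_def csubspace_iff)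
    show "br' x y \<in> G m" if "x \<in> G m" "y \<in> G m"
    proof -
      have "x \<in> g" "y \<in> g" using that Gg by auto
      then show ?thesis using G(1)[of m] that by (simp add: sb.same subalgebra_def)
    qed
    show "\<exists>F. finite F \<and> cspan F = G m" using G(1)[of m] by (auto simp: finite_dim_def)
    show "reductive_in br' (G m) (G m)" "reductive_in br' (G m) (G (Suc m))"
      using G(1,3) Gg by (simp_all add: sb.reductive_in_same reductive_def)
  qed (rule G(2))
  have alg: "rc.alg = g" using G(4) by (simp add: rc.alg_def)
  note R = faithful_repD[OF \<rho>(1)]
  interpret fc: finitary_chain br' G \<rho>'
  proof
    fix x y :: 'a and u v :: 'v and c
    show "\<rho>' (x + y) v = \<rho>' x v + \<rho>' y v" by (simp add: \<rho>'_def \<pi>(1,3) R(3))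
    show "\<rho>' (c *\<^sub>C x) v = c *\<^sub>C \<rho>' x v" by (simp add: \<rho>'_def \<pi>(2,3) R(4))
    show "\<rho>' x (u + v) = \<rho>' x u + \<rho>' x v" "\<rho>' x (c *\<^sub>C v) = c *\<^sub>C \<rho>' x v"
      by (simp_all add: \<rho>'_def \<pi>(3) R(1,2))
    show "\<rho>' (br' x y) v = \<rho>' x (\<rho>' y v) - \<rho>' y (\<rho>' x v)"
      by (simp add: \<rho>'_def br'_def \<pi>(3,4) L(2) R(5))
    show "x = 0" if "x \<in> rc.alg" "\<And>v. \<rho>' x v = 0"
    proof -
      have x: "x \<in> g" using that(1) alg by simp
      have 0: "0 \<in> g" using cv.subspace_0[OF sb.g_sub] .
      have "\<rho> x = \<rho> 0"
      proof
        fix u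
        show "\<rho> x u = \<rho> 0 u" using that(2)[of u] R(4)[OF x, of 0 u] x by (simp add: \<rho>'_def \<pi>(4))
      qed
      then show ?thesis using inj_onD[OF R(6) _ x 0] by simp
    qed
    show "\<exists>F. finite F \<and> range (\<rho>' x) \<subseteq> cspan F" if "x \<in> rc.alg"
      using \<rho>(2)[rule_format, OF \<pi>(3)[of x]] unfolding finite_matrix_def \<rho>'_def by metis
  qed
  have "borel br' g b" using assms(5) sb.borel_same[OF order_refl] by simp
  then have "borel br' (derived br' g) (b \<inter> derived br' g)"
    using fc.borel_derived[of b] by (simp add: alg)
  then show ?thesis
    by (simp add: sb.derived_same sb.borel_same[OF sb.derived_g])
qed

end
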